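(* Let $n\ge1$, let $\mathfrak A$ be a Banach algebra, let $\mathcal A$ and $\mathcal B$ be Banach algebras which are commutative Banach $\mathfrak A$-modules, and let $\mathcal M$ be a Banach $\mathcal A,\mathcal B$-module which is a commutative Banach $\mathfrak A$-module. Suppose that $\mathcal A$ or $\mathcal B$ has a bounded approximate identity and that $\mathcal A^{(2n)}$, $\mathcal B^{(2n)}$ and $\mathcal M^{(2n)}$ are non-degenerate. Let $\mathcal T=\begin{bmatrix}\mathcal A&\mathcal M\\&\mathcal B\end{bmatrix}$. If $\mathcal A$ and $\mathcal B$ are $(2n)$-weakly module amenable as $\mathfrak A$-modules, then $$\mathcal H^1_{\mathfrak T}(\mathcal T,\mathcal T^{(2n)})\simeq \mathrm{Hom}_{\mathfrak A,\mathcal A,\mathcal B}(\mathcal M,\mathcal M^{(2n)})\big/ZR_{\mathfrak A,\mathcal A,\mathcal B}(\mathcal M,\mathcal M^{(2n)}).$$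
   Context: A Banach algebra $\mathcal A$ is a Banach $\mathfrak A$-module (with compatible actions) if it is a Banach $\mathfrak A$-bimodule with $\alpha\cdot(ab)=(\alpha\cdot a)b$, $(ab)\cdot\alpha=a(b\cdot\alpha)$. A Banach $\mathfrak A$-bimodule $X$ is commutative if $\alpha\cdot x=x\cdot\alpha$ for all $\alpha,x$. A Banach $\mathcal A,\mathcal B$-module $\mathcal M$ is a left Banach $\mathcal A$-module and right Banach $\mathcal B$-module with $(a\cdot m)\cdot b=a\cdot(m\cdot b)$; it is also a Banach $\mathfrak A$-bimodule with compatible actions $\alpha\cdot(a\cdot m)=(\alpha\cdot a)\cdot m$, $(\alpha\cdot m)\cdot b=\alpha\cdot(m\cdot b)$, $m\cdot(b\cdot\alpha)=(m\cdot b)\cdot\alpha$, $(a\cdot m)\cdot\alpha=a\cdot(m\cdot\alpha)$. A Banach $\mathcal A,\mathcal B$-module $X$ is non-degenerate if $\mathcal A x=\{0\}$ implies $x=0$ and $x\mathcal B=\{0\}$ implies $x=0$; $\mathcal A^{(2n)}$ is regarded as an $\mathcal A,\mathcal A$-module, $\mathcal B^{(2n)}$ as a $\mathcal B,\mathcal B$-module, $\mathcal M^{(2n)}$ as an $\mathcal A,\mathcal B$-module. $\mathcal T=\left\{\begin{bmatrix}a&m\\&b\end{bmatrix}\right\}$ has the usual $2\times2$ matrix operations and norm $\|a\|+\|m\|+\|b\|$; $\mathfrak T=\left\{\begin{bmatrix}\alpha&\\&\alpha\end{bmatrix}:\alpha\in\mathfrak A\right\}$ acts entrywise on both sides. $X^{(k)}$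 denotes the $k$-th dual with iterated dual actions ($\langle f\cdot a,x\rangle=\langle f,a\cdot x\rangle$, $\langle a\cdot f,x\rangle=\langle f,x\cdot a\rangle$, likewise for $\mathfrak A$). For $\lambda\in\mathcal A^{(2k)},\mu\in\mathcal B^{(2k)}$, $m\in\mathcal M$ the elements $\lambda\cdot m,m\cdot\mu\in\mathcal M^{(2k)}$ are defined inductively (starting from the module actions at $k=0$) by $\langle\lambda\cdot m,\varphi\rangle=\langle\lambda,m\varphi\rangle$, $\langle m\cdot\mu,\varphi\rangle=\langle\mu,\varphi m\rangle$ for $\varphi\in\mathcal M^{(2k-1)}$, where $m\varphi\in\mathcal A^{(2k-1)}$, $\varphi m\in\mathcal B^{(2k-1)}$ are given by $\langle m\varphi,\lambda'\rangle=\langle\varphi,\lambda'\cdot m\rangle$, $\langle\varphi m,\mu'\rangle=\langle\varphi,m\cdot\mu'\rangle$ for $\lambda'\in\mathcal A^{(2k-2)}$, $\mu'\in\mathcal B^{(2k-2)}$. An $\mathfrak A$-module map is an additive map commuting with the left and right $\mathfrak A$-actions (not necessarily $\mathbb C$-linear). A module derivation $D:\mathcal A\to X$ is a bounded $\mathfrak A$-module map ($\|D(a)\|\le M\|a\|$) with $D(ab)=D(a)\cdot b+a\cdot D(b)$; it is inner if $D(a)=a\cdot x-x\cdot a$ for some $x\in X$. $\mathcal H^1_{\mathfrak A}(\mathcal A,X)$ is the quotient of the space of module derivations by the space of inner ones; similarly for $\mathcal T$ and $\mathfrak T$. $\simeq$ denotes isomorphism of vector spaces. $\mathcal A$ is $k$-weakly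 module amenable (as an $\mathfrak A$-module) if $(\mathcal A/J)^{(k)}$ is a commutative $\mathcal A$-$\mathfrak A$-module and every module derivation $\mathcal A\to(\mathcal A/J)^{(k)}$ is inner, $J$ being the closed ideal generated by the elements $(a\cdot\alpha)b-a(\alpha\cdot b)$. For $\mathcal A$ a commutative $\mathfrak A$-module, $J=\{0\}$ and $\mathcal A^{(k)}$ is automatically a commutative $\mathcal A$-$\mathfrak A$-module, so this says that every module derivation $\mathcal A\to\mathcal A^{(k)}$ is inner. $Z_{\mathcal A}(\mathcal A^{(2n)})=\{x\in\mathcal A^{(2n)}:x\cdot a=a\cdot x\ \forall a\in\mathcal A\}$, similarly $Z_{\mathcal B}(\mathcal B^{(2n)})$. $ZR_{\mathfrak A,\mathcal A,\mathcal B}(\mathcal M,\mathcal M^{(2n)})$ is the set of maps $\rho_{x,z}:\mathcal M\to\mathcal M^{(2n)}$, $\rho_{x,z}(m)=x\cdot m-m\cdot z$ (which are $\mathfrak A$-module maps), with $x\in Z_{\mathcal A}(\mathcal A^{(2n)})$, $z\in Z_{\mathcal B}(\mathcal B^{(2n)})$. $\mathrm{Hom}_{\mathfrak A,\mathcal A,\mathcal B}(\mathcal M,\mathcal M^{(2n)})$ is the set of continuous additive maps $\varphi:\mathcal M\to\mathcal M^{(2n)}$ with $\varphi(a\cdot m)=a\cdot\varphi(m)$, $\varphi(m\cdot b)=\varphi(m)\cdot b$, $\varphi(\alpha\cdot m)=\alpha\cdot\varphi(m)$, $\varphi(m\cdot\alpha)=\varphi(m)\cdot\alpha$. *)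

theory Defs
  imports
    "HOL-Analysis.Analysis"
    "HOL-Probability.Discrete_Topology"
    "HOL-Library.Function_Algebras"
    "HOL-Library.Set_Algebras"
begin

section \<open>Complex vector spaces and Banach algebras\<close>

class scaleC =
  fixes scaleC :: "complex \<Rightarrow> 'a \<Rightarrow> 'a"  (infixr "*\<^sub>C" 75)

class complex_vector = scaleC + ab_group_add +
  assumes scaleC_add_right: "c *\<^sub>C (x + y) = c *\<^sub>C x + c *\<^sub>C y"
    and scaleC_add_left: "(c + d) *\<^sub>C x = c *\<^sub>C x + d *\<^sub>C x"
    and scaleC_scaleC: "c *\<^sub>C (d *\<^sub>C x) = (c * d) *\<^sub>C x"
    and scaleC_one: "1 *\<^sub>C x = x"

class complex_normed_vector = complex_vector + real_normed_vector +
  assumes scaleR_scaleC: "r *\<^sub>R x = complex_of_real r *\<^sub>C x"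
    and norm_scaleC: "norm (c *\<^sub>C x) = cmod c * norm x"

class complex_banach = complex_normed_vector + banach

text \<open>Algebras are not assumed to be unital.\<close>

class complex_banach_algebra = complex_banach + real_normed_algebra +
  assumes mult_scaleC_left: "(c *\<^sub>C x) * y = c *\<^sub>C (x * y)"
    and mult_scaleC_right: "x * (c *\<^sub>C y) = c *\<^sub>C (x * y)"

global_interpretation complex_vector: vector_space "scaleC :: complex \<Rightarrow> 'a \<Rightarrow> 'a::complex_vector"
  by standard (fact scaleC_add_right scaleC_add_left scaleC_scaleC scaleC_one)+

abbreviation csubspace :: "'a::complex_vector set \<Rightarrow> bool" where
  "csubspace \<equiv> module.subspace scaleC"

abbreviation clinear :: "('a::complex_vector \<Rightarrow> 'b::complex_vector) \<Rightarrow> bool" where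
  "clinear \<equiv> Vector_Spaces.linear scaleC scaleC"

instantiation "fun" :: (type, complex_vector) complex_vector
begin

definition scaleC_fun :: "complex \<Rightarrow> ('a \<Rightarrow> 'b) \<Rightarrow> 'a \<Rightarrow> 'b" where
  "c *\<^sub>C f = (\<lambda>x. c *\<^sub>C f x)"

instance
  by standard (auto simp: scaleC_fun_def fun_eq_iff
      scaleC_add_right scaleC_add_left scaleC_scaleC scaleC_one)

end


section \<open>Isomorphism of quotient spaces\<close>

definition quotient_space :: "'v::complex_vector set \<Rightarrow> 'v set \<Rightarrow> 'v set set" where
  "quotient_space V W = (\<lambda>v. v +o W) ` V"

text \<open>The sum of cosets is their elementwise sum. The multiple by a scalar \<open>c\<close> needs
  the extra summand \<open>W\<close> to be a coset also for \<open>c = 0\<close>.\<close>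

definition quotient_scale :: "'v::complex_vector set \<Rightarrow> complex \<Rightarrow> 'v set \<Rightarrow> 'v set" where
  "quotient_scale W c C = scaleC c ` C + W"

definition quotients_isomorphic ::
  "'v::complex_vector set \<Rightarrow> 'v set \<Rightarrow> 'w::complex_vector set \<Rightarrow> 'w set \<Rightarrow> bool" where
  "quotients_isomorphic V W V' W' \<longleftrightarrow>
     csubspace V \<and> csubspace W \<and> W \<subseteq> V \<and> csubspace V' \<and> csubspace W' \<and> W' \<subseteq> V' \<and>
     (\<exists>\<Phi>. bij_betw \<Phi> (quotient_space V W) (quotient_space V' W') \<and>
        (\<forall>C \<in> quotient_space V W. \<forall>D \<in> quotient_space V W. \<Phi> (C + D) = \<Phi> C + \<Phi> D) \<and>
        (\<forall>c. \<forall>C \<in> quotient_space V W.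
           \<Phi> (quotient_scale W c C) = quotient_scale W' c (\<Phi> C)))"


section \<open>Iterated duals\<close>

definition bounded_functional_on :: "'u::complex_normed_vector set \<Rightarrow> ('u \<Rightarrow> complex) \<Rightarrow> bool" where
  "bounded_functional_on X \<phi> \<longleftrightarrow>
     (\<forall>x \<in> X. \<forall>y \<in> X. \<phi> (x + y) = \<phi> x + \<phi> y) \<and>
     (\<forall>c. \<forall>x \<in> X. \<phi> (c *\<^sub>C x) = c * \<phi> x) \<and>
     (\<exists>K. \<forall>x \<in> X. cmod (\<phi> x) \<le> K * norm x)"

text \<open>\<open>dual_pairing X Y p\<close>: via \<open>p f x = \<langle>f, x\<rangle>\<close>, the normed space \<open>Y\<close> is (isometrically
  isomorphic to) the space of all bounded linear functionals on the normed space \<open>X\<close>.\<close>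

definition dual_pairing ::
  "'u::complex_normed_vector set \<Rightarrow> 'v::complex_normed_vector set \<Rightarrow> ('v \<Rightarrow> 'u \<Rightarrow> complex) \<Rightarrow> bool" where
  "dual_pairing X Y p \<longleftrightarrow>
     csubspace X \<and> csubspace Y \<and>
     (\<forall>f \<in> Y. bounded_functional_on X (p f)) \<and>
     (\<forall>f \<in> Y. \<forall>g \<in> Y. \<forall>x \<in> X. p (f + g) x = p f x + p g x) \<and>
     (\<forall>c. \<forall>f \<in> Y. \<forall>x \<in> X. p (c *\<^sub>C f) x = c * p f x) \<and>
     (\<forall>f \<in> Y. norm f = (SUP x \<in> {x \<in> X. norm x \<le> 1}. cmod (p f x))) \<and>
     (\<forall>\<phi>. bounded_functional_on X \<phi> \<longrightarrow> (\<exists>f \<in> Y. \<forall>x \<in> X. p f x = \<phi> x))"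

text \<open>
  No HOL type depending uniformly on \<open>'x\<close> contains the duals of all finite orders of a space
  of type \<open>'x\<close>. The duals of order \<open>0, \<dots>, N\<close> are therefore realised as subspaces
  \<open>lev E 0, \<dots>, lev E N\<close> of one normed space \<open>'u\<close>, which is only a container: \<open>lev E (k + 1)\<close>
  is identified with the dual of \<open>lev E k\<close> by the pairing \<open>pr E k\<close>.
  The bottom space is \<open>'x\<close> modulo a closed subspace \<open>J\<close> with the quotient norm, and \<open>emb E\<close> is
  the quotient map; for \<open>J = {0}\<close> it is an isometry of \<open>'x\<close> onto \<open>lev E 0\<close>.
  Below, lemmas \<open>iterated_dual_0_exists\<close> and \<open>iterated_dual_Suc_exists\<close> show that
  such a realisation exists for every \<open>N\<close>.
\<close>

record ('x, 'u) dual_tower =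
  emb :: "'x \<Rightarrow> 'u"
  lev :: "nat \<Rightarrow> 'u set"
  pr :: "nat \<Rightarrow> 'u \<Rightarrow> 'u \<Rightarrow> complex"

definition iterated_dual ::
  "nat \<Rightarrow> 'x::complex_normed_vector set \<Rightarrow> ('x, 'u::complex_normed_vector) dual_tower \<Rightarrow> bool" where
  "iterated_dual N J E \<longleftrightarrow>
     clinear (emb E) \<and> range (emb E) = lev E 0 \<and> (\<forall>x. norm (emb E x) = infdist x J) \<and>
     (\<forall>k < N. dual_pairing (lev E k) (lev E (Suc k)) (pr E k))"

text \<open>\<open>dual_map E F k T\<close> is the transpose \<open>F\<^sup>(\<^sup>k\<^sup>+\<^sup>1\<^sup>) \<rightarrow> E\<^sup>(\<^sup>k\<^sup>+\<^sup>1\<^sup>)\<close> of a map \<open>T : E\<^sup>(\<^sup>k\<^sup>) \<rightarrow> F\<^sup>(\<^sup>k\<^sup>)\<close>.\<close>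

definition dual_map ::
  "('x, 'u) dual_tower \<Rightarrow> ('y, 'v) dual_tower \<Rightarrow> nat \<Rightarrow> ('u \<Rightarrow> 'v) \<Rightarrow> 'v \<Rightarrow> 'u" where
  "dual_map E F k T f =
     (THE g. g \<in> lev E (Suc k) \<and> (\<forall>x \<in> lev E k. pr E k g x = pr F k f (T x)))"

text \<open>The map induced by \<open>S\<close> on the bottom spaces of two towers.\<close>

definition base_map ::
  "('x, 'u) dual_tower \<Rightarrow> ('y, 'v) dual_tower \<Rightarrow> ('x \<Rightarrow> 'y) \<Rightarrow> 'u \<Rightarrow> 'v" where
  "base_map E F S = (\<lambda>\<xi>. emb F (S (inv_into UNIV (emb E) \<xi>)))"

primrec iterated_dual_map :: "('x, 'u) dual_tower \<Rightarrow> ('x \<Rightarrow> 'x) \<Rightarrow> nat \<Rightarrow> 'u \<Rightarrow> 'u" where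
  "iterated_dual_map E S 0 = base_map E E S"
| "iterated_dual_map E S (Suc k) = dual_map E E k (iterated_dual_map E S k)"

text \<open>The actions of \<open>s\<close> on the \<open>k\<close>-th dual of a bimodule with left action \<open>l\<close> and right action
  \<open>r\<close>. Passing to a dual exchanges the sides, \<open>\<langle>f \<cdot> s, x\<rangle> = \<langle>f, s \<cdot> x\<rangle>\<close> and
  \<open>\<langle>s \<cdot> f, x\<rangle> = \<langle>f, x \<cdot> s\<rangle>\<close>, so that the left action on a dual of odd order is an iterated
  transpose of the original right action.\<close>

definition dual_left ::
  "('x, 'u) dual_tower \<Rightarrow> nat \<Rightarrow> ('s \<Rightarrow> 'x \<Rightarrow> 'x) \<Rightarrow> ('x \<Rightarrow> 's \<Rightarrow> 'x) \<Rightarrow> 's \<Rightarrow> 'u \<Rightarrow> 'u" where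
  "dual_left E k l r s = iterated_dual_map E (if even k then l s else (\<lambda>x. r x s)) k"

definition dual_right ::
  "('x, 'u) dual_tower \<Rightarrow> nat \<Rightarrow> ('s \<Rightarrow> 'x \<Rightarrow> 'x) \<Rightarrow> ('x \<Rightarrow> 's \<Rightarrow> 'x) \<Rightarrow> 'u \<Rightarrow> 's \<Rightarrow> 'u" where
  "dual_right E k l r \<xi> s = iterated_dual_map E (if even k then (\<lambda>x. r x s) else l s) k \<xi>"

text \<open>The same for duals of even order \<open>2k\<close> when different algebras act on the two sides.\<close>

definition even_dual_left ::
  "('x, 'u) dual_tower \<Rightarrow> nat \<Rightarrow> ('s \<Rightarrow> 'x \<Rightarrow> 'x) \<Rightarrow> 's \<Rightarrow> 'u \<Rightarrow> 'u" where
  "even_dual_left E k l s = iterated_dual_map E (l s) (2 * k)"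

definition even_dual_right ::
  "('x, 'u) dual_tower \<Rightarrow> nat \<Rightarrow> ('x \<Rightarrow> 's \<Rightarrow> 'x) \<Rightarrow> 'u \<Rightarrow> 's \<Rightarrow> 'u" where
  "even_dual_right E k r \<xi> s = iterated_dual_map E (\<lambda>x. r x s) (2 * k) \<xi>"

text \<open>For \<open>\<lambda> \<in> A\<^sup>(\<^sup>2\<^sup>k\<^sup>)\<close> and \<open>m \<in> M\<close>, \<open>ext_left EA EM act m k \<lambda>\<close> is \<open>\<lambda> \<cdot> m \<in> M\<^sup>(\<^sup>2\<^sup>k\<^sup>)\<close>:
  the inner \<open>dual_map\<close> is \<open>\<phi> \<mapsto> m\<phi>\<close> with \<open>\<langle>m\<phi>, \<lambda>'\<rangle> = \<langle>\<phi>, \<lambda>' \<cdot> m\<rangle>\<close>, and the outer one gives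
  \<open>\<langle>\<lambda> \<cdot> m, \<phi>\<rangle> = \<langle>\<lambda>, m\<phi>\<rangle>\<close>. Likewise \<open>ext_right EB EM act m k \<mu>\<close> is \<open>m \<cdot> \<mu>\<close>.\<close>

primrec ext_left ::
  "('a, 'ua) dual_tower \<Rightarrow> ('m, 'um) dual_tower \<Rightarrow> ('a \<Rightarrow> 'm \<Rightarrow> 'm) \<Rightarrow> 'm \<Rightarrow> nat \<Rightarrow> 'ua \<Rightarrow> 'um" where
  "ext_left EA EM act m 0 = base_map EA EM (\<lambda>a. act a m)"
| "ext_left EA EM act m (Suc k) =
     dual_map EM EA (2 * k + 1) (dual_map EA EM (2 * k) (ext_left EA EM act m k))"

primrec ext_right ::
  "('b, 'ub) dual_tower \<Rightarrow> ('m, 'um) dual_tower \<Rightarrow> ('m \<Rightarrow> 'b \<Rightarrow> 'm) \<Rightarrow> 'm \<Rightarrow> nat \<Rightarrow> 'ub \<Rightarrow> 'um" where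
  "ext_right EB EM act m 0 = base_map EB EM (\<lambda>b. act m b)"
| "ext_right EB EM act m (Suc k) =
     dual_map EM EB (2 * k + 1) (dual_map EB EM (2 * k) (ext_right EB EM act m k))"


section \<open>Banach modules\<close>

definition bounded_cbilinear ::
  "('x::complex_normed_vector \<Rightarrow> 'y::complex_normed_vector \<Rightarrow> 'z::complex_normed_vector) \<Rightarrow> bool" where
  "bounded_cbilinear f \<longleftrightarrow> bounded_bilinear f \<and>
     (\<forall>c x y. f (c *\<^sub>C x) y = c *\<^sub>C f x y \<and> f x (c *\<^sub>C y) = c *\<^sub>C f x y)"

definition left_banach_module ::
  "('s::complex_banach_algebra \<Rightarrow> 'x::complex_banach \<Rightarrow> 'x) \<Rightarrow> bool" where
  "left_banach_module l \<longleftrightarrow> bounded_cbilinear l \<and> (\<forall>s t x. l (s * t) x = l s (l t x))"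

definition right_banach_module ::
  "('x::complex_banach \<Rightarrow> 's::complex_banach_algebra \<Rightarrow> 'x) \<Rightarrow> bool" where
  "right_banach_module r \<longleftrightarrow> bounded_cbilinear r \<and> (\<forall>s t x. r x (s * t) = r (r x s) t)"

text \<open>A Banach module over \<open>'s\<close> on the left and \<open>'t\<close> on the right.\<close>

definition banach_bimodule ::
  "('s::complex_banach_algebra \<Rightarrow> 'x::complex_banach \<Rightarrow> 'x) \<Rightarrow>
   ('x \<Rightarrow> 't::complex_banach_algebra \<Rightarrow> 'x) \<Rightarrow> bool" where
  "banach_bimodule l r \<longleftrightarrow> left_banach_module l \<and> right_banach_module r \<and>
     (\<forall>s x t. r (l s x) t = l s (r x t))"

definition commutative_actions :: "('k \<Rightarrow> 'x \<Rightarrow> 'x) \<Rightarrow> ('x \<Rightarrow> 'k \<Rightarrow> 'x) \<Rightarrow> bool" where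
  "commutative_actions l r \<longleftrightarrow> (\<forall>\<alpha> x. l \<alpha> x = r x \<alpha>)"

definition banach_algebra_module ::
  "('k::complex_banach_algebra \<Rightarrow> 'a::complex_banach_algebra \<Rightarrow> 'a) \<Rightarrow> ('a \<Rightarrow> 'k \<Rightarrow> 'a) \<Rightarrow> bool" where
  "banach_algebra_module l r \<longleftrightarrow> banach_bimodule l r \<and>
     (\<forall>\<alpha> a b. l \<alpha> (a * b) = l \<alpha> a * b) \<and> (\<forall>\<alpha> a b. r (a * b) \<alpha> = a * r b \<alpha>)"

text \<open>A Banach \<open>A,B\<close>-module (actions \<open>act\<^sub>A\<close>, \<open>act\<^sub>B\<close>) with a compatible \<open>'k\<close>-bimodule structure
  \<open>lM\<close>, \<open>rM\<close>; \<open>lA\<close> is the left action of \<open>'k\<close> on \<open>A\<close> and \<open>rB\<close> its right action on \<open>B\<close>.\<close>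

definition banach_AB_module ::
  "('k::complex_banach_algebra \<Rightarrow> 'a::complex_banach_algebra \<Rightarrow> 'a) \<Rightarrow>
   ('b::complex_banach_algebra \<Rightarrow> 'k \<Rightarrow> 'b) \<Rightarrow>
   ('k \<Rightarrow> 'm::complex_banach \<Rightarrow> 'm) \<Rightarrow> ('m \<Rightarrow> 'k \<Rightarrow> 'm) \<Rightarrow>
   ('a \<Rightarrow> 'm \<Rightarrow> 'm) \<Rightarrow> ('m \<Rightarrow> 'b \<Rightarrow> 'm) \<Rightarrow> bool" where
  "banach_AB_module lA rB lM rM act\<^sub>A act\<^sub>B \<longleftrightarrow>
     banach_bimodule act\<^sub>A act\<^sub>B \<and> banach_bimodule lM rM \<and>
     (\<forall>\<alpha> a m. lM \<alpha> (act\<^sub>A a m) = act\<^sub>A (lA \<alpha> a) m) \<and>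
     (\<forall>\<alpha> m b. act\<^sub>B (lM \<alpha> m) b = lM \<alpha> (act\<^sub>B m b)) \<and>
     (\<forall>\<alpha> m b. act\<^sub>B m (rB b \<alpha>) = rM (act\<^sub>B m b) \<alpha>) \<and>
     (\<forall>\<alpha> a m. rM (act\<^sub>A a m) \<alpha> = act\<^sub>A a (rM m \<alpha>))"

definition nondegenerate ::
  "'u::zero set \<Rightarrow> ('a \<Rightarrow> 'u \<Rightarrow> 'u) \<Rightarrow> ('u \<Rightarrow> 'b \<Rightarrow> 'u) \<Rightarrow> bool" where
  "nondegenerate X l r \<longleftrightarrow>
     (\<forall>x \<in> X. (\<forall>a. l a x = 0) \<longrightarrow> x = 0) \<and> (\<forall>x \<in> X. (\<forall>b. r x b = 0) \<longrightarrow> x = 0)"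

text \<open>A two-sided bounded approximate identity, the net being replaced by the filter it
  generates on the algebra.\<close>

definition bounded_approximate_identity :: "'a::complex_banach_algebra filter \<Rightarrow> bool" where
  "bounded_approximate_identity F \<longleftrightarrow> F \<noteq> bot \<and> (\<exists>K. \<forall>\<^sub>F e in F. norm e \<le> K) \<and>
     (\<forall>a. ((\<lambda>e. e * a) \<longlongrightarrow> a) F \<and> ((\<lambda>e. a * e) \<longlongrightarrow> a) F)"


section \<open>Module derivations and weak module amenability\<close>

text \<open>An algebra with multiplication \<open>mul\<close> and \<open>'s\<close>-actions \<open>l\<close>, \<open>r\<close>; the target \<open>X\<close> has actions
  \<open>al\<close>, \<open>ar\<close> of the algebra and \<open>sl\<close>, \<open>sr\<close> of \<open>'s\<close>.\<close>

definition module_derivations ::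
  "('a::complex_normed_vector \<Rightarrow> 'a \<Rightarrow> 'a) \<Rightarrow> ('s \<Rightarrow> 'a \<Rightarrow> 'a) \<Rightarrow> ('a \<Rightarrow> 's \<Rightarrow> 'a) \<Rightarrow>
   'u::complex_normed_vector set \<Rightarrow> ('a \<Rightarrow> 'u \<Rightarrow> 'u) \<Rightarrow> ('u \<Rightarrow> 'a \<Rightarrow> 'u) \<Rightarrow>
   ('s \<Rightarrow> 'u \<Rightarrow> 'u) \<Rightarrow> ('u \<Rightarrow> 's \<Rightarrow> 'u) \<Rightarrow> ('a \<Rightarrow> 'u) set" where
  "module_derivations mul l r X al ar sl sr =
     {D. range D \<subseteq> X \<and>
         (\<forall>a b. D (a + b) = D a + D b) \<and>
         (\<forall>s a. D (l s a) = sl s (D a)) \<and> (\<forall>s a. D (r a s) = sr (D a) s) \<and>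
         (\<exists>K. \<forall>a. norm (D a) \<le> K * norm a) \<and>
         (\<forall>a b. D (mul a b) = ar (D a) b + al a (D b))}"

definition inner_on ::
  "'u::ab_group_add set \<Rightarrow> ('a \<Rightarrow> 'u \<Rightarrow> 'u) \<Rightarrow> ('u \<Rightarrow> 'a \<Rightarrow> 'u) \<Rightarrow> ('a \<Rightarrow> 'u) \<Rightarrow> bool" where
  "inner_on X al ar D \<longleftrightarrow> (\<exists>x \<in> X. \<forall>a. D a = al a x - ar x a)"

text \<open>Module derivations, and inner ones, into the \<open>k\<close>-th dual of the tower \<open>E\<close> over the algebra
  itself (or over a quotient of it).\<close>

definition dual_derivations ::
  "nat \<Rightarrow> ('a \<Rightarrow> 'a \<Rightarrow> 'a) \<Rightarrow> ('s \<Rightarrow> 'a \<Rightarrow> 'a) \<Rightarrow> ('a \<Rightarrow> 's \<Rightarrow> 'a) \<Rightarrow>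
   ('a::complex_normed_vector, 'u::complex_normed_vector) dual_tower \<Rightarrow> ('a \<Rightarrow> 'u) set" where
  "dual_derivations k mul l r E = module_derivations mul l r (lev E k)
     (dual_left E k mul mul) (dual_right E k mul mul) (dual_left E k l r) (dual_right E k l r)"

definition inner_dual_derivations ::
  "nat \<Rightarrow> ('a \<Rightarrow> 'a \<Rightarrow> 'a) \<Rightarrow> ('s \<Rightarrow> 'a \<Rightarrow> 'a) \<Rightarrow> ('a \<Rightarrow> 's \<Rightarrow> 'a) \<Rightarrow>
   ('a::complex_normed_vector, 'u::complex_normed_vector) dual_tower \<Rightarrow> ('a \<Rightarrow> 'u) set" where
  "inner_dual_derivations k mul l r E =
     {D \<in> dual_derivations k mul l r E.
        inner_on (lev E k) (dual_left E k mul mul) (dual_right E k mul mul) D}"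

text \<open>The closed ideal \<open>J\<close> generated by the elements \<open>(a \<cdot> \<alpha>) b - a (\<alpha> \<cdot> b)\<close>.\<close>

definition module_ideal ::
  "('k \<Rightarrow> 'a::complex_banach_algebra \<Rightarrow> 'a) \<Rightarrow> ('a \<Rightarrow> 'k \<Rightarrow> 'a) \<Rightarrow> 'a set" where
  "module_ideal l r = \<Inter>{I. closed I \<and> csubspace I \<and> (\<forall>a. \<forall>x \<in> I. a * x \<in> I \<and> x * a \<in> I) \<and>
     (\<forall>a \<alpha> b. r a \<alpha> * b - a * l \<alpha> b \<in> I)}"

text \<open>\<open>k\<close>-weak module amenability of \<open>A\<close>; the tower \<open>E\<close> realises the duals of \<open>A/J\<close>, and the
  property does not depend on its choice. For commutative modules \<open>J = {0}\<close> by
  \<open>module_ideal_commutative\<close> below, so that \<open>E\<close> is then any tower over \<open>A\<close>.\<close>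

definition weakly_module_amenable ::
  "nat \<Rightarrow> ('k \<Rightarrow> 'a::complex_banach_algebra \<Rightarrow> 'a) \<Rightarrow> ('a \<Rightarrow> 'k \<Rightarrow> 'a) \<Rightarrow>
   ('a, 'u::complex_normed_vector) dual_tower \<Rightarrow> bool" where
  "weakly_module_amenable k l r E \<longleftrightarrow>
     iterated_dual k (module_ideal l r) E \<and>
     (\<forall>\<alpha>. \<forall>x \<in> lev E k. dual_left E k l r \<alpha> x = dual_right E k l r x \<alpha>) \<and>
     (\<forall>D \<in> dual_derivations k (*) l r E.
        inner_on (lev E k) (dual_left E k (*) (*)) (dual_right E k (*) (*)) D)"

lemma module_ideal_commutative:
  assumes "banach_algebra_module l r" and "commutative_actions l r"
  shows "module_ideal l r = {0}"
proof
  have "r a \<alpha> * b = a * l \<alpha> b" for a \<alpha> b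
    using assms unfolding banach_algebra_module_def commutative_actions_def by metis
  then show "module_ideal l r \<subseteq> {0}"
    unfolding module_ideal_def by (auto intro!: Inter_lower complex_vector.subspace_single_0)
  show "{0} \<subseteq> module_ideal l r"
    by (auto simp: module_ideal_def dest: complex_vector.subspace_0)
qed


section \<open>Triangular matrices\<close>

text \<open>\<open>Tri a m b\<close> is the upper triangular matrix with diagonal \<open>a\<close>, \<open>b\<close> and corner \<open>m\<close>.\<close>

datatype ('a, 'm, 'b) tri = Tri (ul: 'a) (ur: 'm) (lr: 'b)

definition tri_mult ::
  "('a::complex_banach_algebra \<Rightarrow> 'm::complex_banach \<Rightarrow> 'm) \<Rightarrow>
   ('m \<Rightarrow> 'b::complex_banach_algebra \<Rightarrow> 'm) \<Rightarrow>
   ('a, 'm, 'b) tri \<Rightarrow> ('a, 'm, 'b) tri \<Rightarrow> ('a, 'm, 'b) tri" where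
  "tri_mult act\<^sub>A act\<^sub>B s t =
     Tri (ul s * ul t) (act\<^sub>A (ul s) (ur t) + act\<^sub>B (ur s) (lr t)) (lr s * lr t)"

text \<open>The algebra of scalar matrices: \<open>Diag \<alpha>\<close> is the diagonal matrix with entries \<open>\<alpha>\<close>, \<open>\<alpha>\<close>.\<close>

datatype 'k diag = Diag (entry: 'k)

definition diag_left ::
  "('k \<Rightarrow> 'a \<Rightarrow> 'a) \<Rightarrow> ('k \<Rightarrow> 'm \<Rightarrow> 'm) \<Rightarrow> ('k \<Rightarrow> 'b \<Rightarrow> 'b) \<Rightarrow>
   'k diag \<Rightarrow> ('a, 'm, 'b) tri \<Rightarrow> ('a, 'm, 'b) tri" where
  "diag_left lA lM lB d t = Tri (lA (entry d) (ul t)) (lM (entry d) (ur t)) (lB (entry d) (lr t))"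

definition diag_right ::
  "('a \<Rightarrow> 'k \<Rightarrow> 'a) \<Rightarrow> ('m \<Rightarrow> 'k \<Rightarrow> 'm) \<Rightarrow> ('b \<Rightarrow> 'k \<Rightarrow> 'b) \<Rightarrow>
   ('a, 'm, 'b) tri \<Rightarrow> 'k diag \<Rightarrow> ('a, 'm, 'b) tri" where
  "diag_right rA rM rB t d = Tri (rA (ul t) (entry d)) (rM (ur t) (entry d)) (rB (lr t) (entry d))"

instantiation tri :: (complex_normed_vector, complex_normed_vector, complex_normed_vector)
  complex_normed_vector
begin

definition "0 = Tri 0 0 0"
definition "s + t = Tri (ul s + ul t) (ur s + ur t) (lr s + lr t)"
definition "s - t = Tri (ul s - ul t) (ur s - ur t) (lr s - lr t)"
definition "- t = Tri (- ul t) (- ur t) (- lr t)"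
definition "r *\<^sub>R t = Tri (r *\<^sub>R ul t) (r *\<^sub>R ur t) (r *\<^sub>R lr t)"
definition "c *\<^sub>C t = Tri (c *\<^sub>C ul t) (c *\<^sub>C ur t) (c *\<^sub>C lr t)"
definition "norm t = norm (ul t) + norm (ur t) + norm (lr t)"
definition "sgn t = inverse (norm t) *\<^sub>R t" for t :: "('a, 'b, 'c) tri"
definition "dist s t = norm (s - t)" for s t :: "('a, 'b, 'c) tri"
definition "uniformity =
  (INF e \<in> {0<..}. principal {(s, t :: ('a, 'b, 'c) tri). dist s t < e})"
definition "open U \<longleftrightarrow> (\<forall>s \<in> U. \<forall>\<^sub>F (s', t) in uniformity. s' = s \<longrightarrow> t \<in> U)"
  for U :: "('a, 'b, 'c) tri set"

lemmas tri_arith_defs = zero_tri_def plus_tri_def minus_tri_def uminus_tri_def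
  scaleR_tri_def scaleC_tri_def

instance
proof
  fix s t :: "('a, 'b, 'c) tri" and r :: real and c :: complex
  show "norm (s + t) \<le> norm s + norm t"
    unfolding norm_tri_def plus_tri_def
    using norm_triangle_ineq[of "ul s" "ul t"] norm_triangle_ineq[of "ur s" "ur t"]
      norm_triangle_ineq[of "lr s" "lr t"] by simp
  show "norm t = 0 \<longleftrightarrow> t = 0"
    unfolding norm_tri_def zero_tri_def
    by (cases t) (simp add: add_nonneg_eq_0_iff)
qed (auto simp: tri_arith_defs norm_tri_def sgn_tri_def dist_tri_def uniformity_tri_def
    open_tri_def algebra_simps scaleC_add_right scaleC_add_left scaleC_scaleC scaleC_one
    scaleR_scaleC norm_scaleC)

end


section \<open>The maps of the main theorem\<close>

definition center_dual ::
  "nat \<Rightarrow> ('a::complex_banach_algebra, 'u::complex_normed_vector) dual_tower \<Rightarrow> 'u set" where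
  "center_dual k E =
     {x \<in> lev E k. \<forall>a. dual_right E k (*) (*) x a = dual_left E k (*) (*) a x}"

definition ZR ::
  "nat \<Rightarrow> ('a::complex_banach_algebra, 'ua::complex_normed_vector) dual_tower \<Rightarrow>
   ('b::complex_banach_algebra, 'ub::complex_normed_vector) dual_tower \<Rightarrow>
   ('m::complex_banach, 'um::complex_normed_vector) dual_tower \<Rightarrow>
   ('a \<Rightarrow> 'm \<Rightarrow> 'm) \<Rightarrow> ('m \<Rightarrow> 'b \<Rightarrow> 'm) \<Rightarrow> ('m \<Rightarrow> 'um) set" where
  "ZR n EA EB EM act\<^sub>A act\<^sub>B =
     {(\<lambda>m. ext_left EA EM act\<^sub>A m n x - ext_right EB EM act\<^sub>B m n z) |x z.
        x \<in> center_dual (2 * n) EA \<and> z \<in> center_dual (2 * n) EB}"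

definition module_homs ::
  "nat \<Rightarrow> ('m::complex_banach, 'um::complex_normed_vector) dual_tower \<Rightarrow>
   ('k \<Rightarrow> 'm \<Rightarrow> 'm) \<Rightarrow> ('m \<Rightarrow> 'k \<Rightarrow> 'm) \<Rightarrow> ('a \<Rightarrow> 'm \<Rightarrow> 'm) \<Rightarrow> ('m \<Rightarrow> 'b \<Rightarrow> 'm) \<Rightarrow>
   ('m \<Rightarrow> 'um) set" where
  "module_homs n EM lM rM act\<^sub>A act\<^sub>B =
     {\<phi>. range \<phi> \<subseteq> lev EM (2 * n) \<and> continuous_on UNIV \<phi> \<and>
         (\<forall>m m'. \<phi> (m + m') = \<phi> m + \<phi> m') \<and>
         (\<forall>a m. \<phi> (act\<^sub>A a m) = even_dual_left EM n act\<^sub>A a (\<phi> m)) \<and>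
         (\<forall>m b. \<phi> (act\<^sub>B m b) = even_dual_right EM n act\<^sub>B (\<phi> m) b) \<and>
         (\<forall>\<alpha> m. \<phi> (lM \<alpha> m) = even_dual_left EM n lM \<alpha> (\<phi> m)) \<and>
         (\<forall>m \<alpha>. \<phi> (rM m \<alpha>) = even_dual_right EM n rM (\<phi> m) \<alpha>)}"


section \<open>Existence of iterated duals\<close>

lemma iterated_dual_0_exists:
  "\<exists>E :: ('x::complex_normed_vector, 'x) dual_tower. iterated_dual 0 {0} E"
proof
  show "iterated_dual 0 {0} \<lparr>emb = \<lambda>x::'x. x, lev = \<lambda>_. UNIV, pr = undefined\<rparr>"
    by (auto simp: iterated_dual_def intro: complex_vector.linear_ident)
qed

instantiation prod :: (complex_normed_vector, complex_normed_vector) complex_normed_vector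
begin

definition "c *\<^sub>C x = (c *\<^sub>C fst x, c *\<^sub>C snd x)"

instance
proof
  fix c :: complex and x :: "'a \<times> 'b"
  show "norm (c *\<^sub>C x) = cmod c * norm x"
    unfolding norm_prod_def scaleC_prod_def
    by (simp add: norm_scaleC power_mult_distrib real_sqrt_mult flip: distrib_left)
qed (auto simp: scaleC_prod_def prod_eq_iff scaleC_add_right scaleC_add_left scaleC_scaleC
    scaleC_one scaleR_scaleC)

end

instantiation complex :: complex_banach
begin

definition "c *\<^sub>C z = c * z" for c z :: complex

instance
  by standard (auto simp: scaleC_complex_def algebra_simps norm_mult scaleR_conv_of_real)

end

instantiation bcontfun :: (topological_space, complex_normed_vector) complex_normed_vector
begin

definition scaleC_bcontfun :: "complex \<Rightarrow> 'a \<Rightarrow>\<^sub>C 'b \<Rightarrow> 'a \<Rightarrow>\<^sub>C 'b" where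
  "c *\<^sub>C f = Bcontfun (\<lambda>x. c *\<^sub>C apply_bcontfun f x)"

lemma apply_scaleC_bcontfun: "apply_bcontfun (c *\<^sub>C f) x = c *\<^sub>C apply_bcontfun f x"
  for f :: "'a \<Rightarrow>\<^sub>C 'b"
proof -
  have "continuous_on UNIV (\<lambda>x. c *\<^sub>C apply_bcontfun f x)"
  proof (rule continuous_on_compose2[where g = "\<lambda>y. c *\<^sub>C y" and t = UNIV])
    have "bounded_linear (\<lambda>y :: 'b. c *\<^sub>C y)"
      by (rule bounded_linear_intro[where K = "cmod c"])
        (auto simp: scaleC_add_right scaleR_scaleC scaleC_scaleC norm_scaleC mult.commute)
    then show "continuous_on UNIV (\<lambda>y :: 'b. c *\<^sub>C y)"
      by (rule linear_continuous_on)
  qed auto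
  moreover have "norm (c *\<^sub>C apply_bcontfun f x) \<le> cmod c * norm f" for x
    by (simp add: norm_scaleC mult_left_mono norm_bounded)
  ultimately have "(\<lambda>x. c *\<^sub>C apply_bcontfun f x) \<in> bcontfun"
    by (rule bcontfun_normI)
  then show ?thesis
    by (simp add: scaleC_bcontfun_def Bcontfun_inverse)
qed

instance
proof
  fix c d :: complex and r :: real and f g :: "'a \<Rightarrow>\<^sub>C 'b"
  have le: "norm (c *\<^sub>C f) \<le> cmod c * norm f" for c and f :: "'a \<Rightarrow>\<^sub>C 'b"
    by (rule norm_bound) (simp add: apply_scaleC_bcontfun norm_scaleC mult_left_mono norm_bounded)
  show one: "1 *\<^sub>C f = f" for f :: "'a \<Rightarrow>\<^sub>C 'b"
    by (rule bcontfun_eqI) (simp add: apply_scaleC_bcontfun scaleC_one)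
  show assoc: "c *\<^sub>C (d *\<^sub>C f) = (c * d) *\<^sub>C f" for c d and f :: "'a \<Rightarrow>\<^sub>C 'b"
    by (rule bcontfun_eqI) (simp add: apply_scaleC_bcontfun scaleC_scaleC)
  show "norm (c *\<^sub>C f) = cmod c * norm f"
  proof (cases "c = 0")
    case True
    then show ?thesis using le[of 0 f] by simp
  next
    case False
    have "norm f = norm (inverse c *\<^sub>C (c *\<^sub>C f))"
      using False by (simp add: assoc one)
    also have "\<dots> \<le> cmod (inverse c) * norm (c *\<^sub>C f)"
      by (rule le)
    finally have "cmod c * norm f \<le> norm (c *\<^sub>C f)"
      using False by (simp add: norm_inverse norm_divide field_simps)
    then show ?thesis using le[of c f] by simp
  qed
qed (auto intro!: bcontfun_eqI simp: apply_scaleC_bcontfun scaleC_add_right scaleC_add_left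
    scaleR_scaleC)

end

lemma iterated_dual_Suc_exists:
  fixes E :: "('x::complex_normed_vector, 'u::complex_normed_vector) dual_tower"
  assumes E: "iterated_dual N J E"
  shows "\<exists>E' :: ('x, 'u \<times> ('u discrete \<Rightarrow>\<^sub>C complex)) dual_tower. iterated_dual (Suc N) J E'"
proof -
  define X where "X = lev E N"
  have sub: "csubspace (lev E k)" if "k \<le> N" for k
  proof (cases k)
    case 0
    have "module_hom scaleC scaleC (emb E)" and "range (emb E) = lev E 0"
      using E by (auto simp: iterated_dual_def Vector_Spaces.linear_def)
    then show ?thesis
      using module_hom.subspace_image[of scaleC scaleC "emb E" UNIV] 0 by simp
  next
    case (Suc j)
    then have "dual_pairing (lev E j) (lev E (Suc j)) (pr E j)"
      using E that by (auto simp: iterated_dual_def)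
    then show ?thesis using Suc by (simp add: dual_pairing_def)
  qed
  have X: "csubspace X"
    using sub X_def by simp
  have scX: "c *\<^sub>C x \<in> X" if "x \<in> X" for c x
    using X that by (rule complex_vector.subspace_scale)
  define P where "P = {\<phi>. bounded_functional_on X \<phi>}"
  define cut where "cut \<phi> d =
    (let x = of_discrete d in if x \<in> X \<and> norm x \<le> 1 then \<phi> x else (0::complex))" for \<phi> d
  define \<beta> where "\<beta> \<phi> = Bcontfun (cut \<phi>)" for \<phi>
  define q where "q g x = complex_of_real (norm x) *
    apply_bcontfun g (discrete (inverse (norm x) *\<^sub>R x))" for g :: "'u discrete \<Rightarrow>\<^sub>C complex" and x
  have cont: "continuous_on UNIV h" for h :: "'u discrete \<Rightarrow> complex"
    by (simp add: continuous_on_open_vimage open_discrete)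
  have app: "apply_bcontfun (\<beta> \<phi>) = cut \<phi>" if \<phi>: "\<phi> \<in> P" for \<phi>
  proof -
    obtain K where K: "\<And>x. x \<in> X \<Longrightarrow> cmod (\<phi> x) \<le> K * norm x"
      using \<phi> unfolding P_def bounded_functional_on_def by blast
    have "norm (cut \<phi> d) \<le> \<bar>K\<bar>" for d
    proof (cases "of_discrete d \<in> X \<and> norm (of_discrete d) \<le> 1")
      case True
      have "K * norm (of_discrete d) \<le> \<bar>K\<bar> * 1"
        using True by (intro mult_mono) auto
      then show ?thesis using True K[of "of_discrete d"] by (auto simp: cut_def Let_def)
    qed (auto simp: cut_def Let_def)
    then have "cut \<phi> \<in> bcontfun"
      using cont by (intro bcontfun_normI) auto
    then show ?thesis
      by (simp add: \<beta>_def Bcontfun_inverse)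
  qed
  have q: "q (\<beta> \<phi>) x = \<phi> x" if \<phi>: "\<phi> \<in> P" and x: "x \<in> X" for \<phi> x
  proof (cases "x = 0")
    case True
    have "\<phi> (0 *\<^sub>C x) = 0 * \<phi> x"
      using \<phi> x unfolding P_def bounded_functional_on_def by blast
    then show ?thesis using True by (simp add: q_def)
  next
    case False
    let ?c = "complex_of_real (inverse (norm x))"
    have "?c *\<^sub>C x \<in> X" "norm (?c *\<^sub>C x) = 1" "\<phi> (?c *\<^sub>C x) = ?c * \<phi> x"
      using \<phi> x False scX by (auto simp: P_def bounded_functional_on_def norm_scaleC norm_inverse)
    then show ?thesis
      using False
      by (simp add: q_def app[OF \<phi>] cut_def Let_def scaleR_scaleC discrete_inverse)
  qed
  have cutD: "cut \<phi> d = 0 \<or> (\<exists>x \<in> X. norm x \<le> 1 \<and> cut \<phi> d = \<phi> x)" for \<phi> d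
    by (auto simp: cut_def Let_def)
  have Padd: "(\<lambda>x. \<phi> x + \<psi> x) \<in> P" if \<phi>: "\<phi> \<in> P" and \<psi>: "\<psi> \<in> P" for \<phi> \<psi>
  proof -
    obtain K L where "\<And>x. x \<in> X \<Longrightarrow> cmod (\<phi> x) \<le> K * norm x"
      and "\<And>x. x \<in> X \<Longrightarrow> cmod (\<psi> x) \<le> L * norm x"
      using \<phi> \<psi> unfolding P_def bounded_functional_on_def by blast
    then have "\<And>x. x \<in> X \<Longrightarrow> cmod (\<phi> x + \<psi> x) \<le> (K + L) * norm x"
      by (metis add_mono distrib_right norm_triangle_mono)
    then have "\<exists>K. \<forall>x \<in> X. cmod (\<phi> x + \<psi> x) \<le> K * norm x"
      by blast
    then show ?thesis
      using \<phi> \<psi> unfolding P_def bounded_functional_on_def by (simp add: distrib_left mult.left_commute)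
  qed
  have Pscale: "(\<lambda>x. c * \<phi> x) \<in> P" if \<phi>: "\<phi> \<in> P" for \<phi> c
  proof -
    obtain K where "\<And>x. x \<in> X \<Longrightarrow> cmod (\<phi> x) \<le> K * norm x"
      using \<phi> unfolding P_def bounded_functional_on_def by blast
    then have "\<And>x. x \<in> X \<Longrightarrow> cmod (c * \<phi> x) \<le> (cmod c * K) * norm x"
      by (simp add: norm_mult mult.assoc mult_left_mono)
    then have "\<exists>K. \<forall>x \<in> X. cmod (c * \<phi> x) \<le> K * norm x"
      by blast
    then show ?thesis
      using \<phi> unfolding P_def bounded_functional_on_def by (simp add: distrib_left mult.left_commute)
  qed
  have P0: "(\<lambda>_. 0) \<in> P"
    by (auto simp: P_def bounded_functional_on_def intro: exI[of _ 0])
  have \<beta>add: "\<beta> (\<lambda>x. \<phi> x + \<psi> x) = \<beta> \<phi> + \<beta> \<psi>" if "\<phi> \<in> P" "\<psi> \<in> P" for \<phi> \<psi>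
    by (rule bcontfun_eqI) (auto simp: app that Padd cut_def Let_def)
  have \<beta>scale: "\<beta> (\<lambda>x. c * \<phi> x) = c *\<^sub>C \<beta> \<phi>" if "\<phi> \<in> P" for \<phi> c
    by (rule bcontfun_eqI)
      (auto simp: app that Pscale cut_def Let_def apply_scaleC_bcontfun scaleC_complex_def)
  have \<beta>0: "\<beta> (\<lambda>_. 0) = 0"
    by (rule bcontfun_eqI) (auto simp: app P0 cut_def Let_def)
  have \<beta>norm: "norm (\<beta> \<phi>) = (SUP x \<in> {x \<in> X. norm x \<le> 1}. cmod (\<phi> x))" (is "_ = ?S")
    if \<phi>: "\<phi> \<in> P" for \<phi>
  proof (rule antisym)
    have le: "cmod (\<phi> x) \<le> norm (\<beta> \<phi>)" if "x \<in> X" "norm x \<le> 1" for x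
      using norm_bounded[of "\<beta> \<phi>" "discrete x"] that
      by (simp add: app[OF \<phi>] cut_def Let_def discrete_inverse)
    have 0: "0 \<in> X"
      using X by (rule complex_vector.subspace_0)
    have bdd: "bdd_above ((\<lambda>x. cmod (\<phi> x)) ` {x \<in> X. norm x \<le> 1})"
      using le by (auto simp: bdd_above_def)
    show "?S \<le> norm (\<beta> \<phi>)"
      using 0 le by (intro cSUP_least) auto
    have up: "cmod (\<phi> x) \<le> ?S" if "x \<in> X" "norm x \<le> 1" for x
      using that by (intro cSUP_upper bdd) auto
    have "0 \<le> ?S"
      by (rule order_trans[OF norm_ge_zero up[OF 0]]) simp
    then have "norm (cut \<phi> d) \<le> ?S" for d
      using cutD[of \<phi> d] up by (elim disjE bexE) auto
    then show "norm (\<beta> \<phi>) \<le> ?S"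
      by (intro norm_bound) (simp only: app[OF \<phi>])
  qed
  have PX: "\<phi> \<in> P \<longleftrightarrow> bounded_functional_on X \<phi>" for \<phi>
    by (simp add: P_def)
  have P_cong: "\<phi> \<in> P \<longleftrightarrow> \<psi> \<in> P" if "\<And>x. x \<in> X \<Longrightarrow> \<phi> x = \<psi> x" for \<phi> \<psi>
    using that X
    by (auto simp: P_def bounded_functional_on_def complex_vector.subspace_add
        complex_vector.subspace_scale)
  define lev' where "lev' k = (if k \<le> N then lev E k \<times> {0} else {0} \<times> \<beta> ` P)" for k
  define pr' where "pr' k f x = (if k < N then pr E k (fst f) (fst x) else q (snd f) (fst x))"
    for k and f x :: "'u \<times> ('u discrete \<Rightarrow>\<^sub>C complex)"
  define E' where "E' = \<lparr>emb = \<lambda>x. (emb E x, 0), lev = lev', pr = pr'\<rparr>"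
  have sub': "csubspace (Z \<times> {0 :: 'u discrete \<Rightarrow>\<^sub>C complex})" if "csubspace Z" for Z :: "'u set"
    using that by (auto simp: complex_vector.subspace_def scaleC_prod_def zero_prod_def)
  have bf': "bounded_functional_on (Z \<times> {0 :: 'u discrete \<Rightarrow>\<^sub>C complex}) \<phi> \<longleftrightarrow>
      bounded_functional_on Z (\<lambda>x. \<phi> (x, 0))" for Z :: "'u set" and \<phi>
    by (auto simp: bounded_functional_on_def scaleC_prod_def norm_prod_def)
  have ball': "{x \<in> Z \<times> {0 :: 'u discrete \<Rightarrow>\<^sub>C complex}. norm x \<le> 1} =
      (\<lambda>x. (x, 0)) ` {x \<in> Z. norm x \<le> 1}" for Z :: "'u set"
    by (force simp: norm_Pair)
  have norm0: "norm (x, 0 :: 'u discrete \<Rightarrow>\<^sub>C complex) = norm x" "norm (0 :: 'u, g) = norm g"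
    for x :: 'u and g :: "'u discrete \<Rightarrow>\<^sub>C complex"
    by (simp_all add: norm_Pair)
  have "dual_pairing (lev' k) (lev' (Suc k)) (pr' k)" if "k < Suc N" for k
  proof (cases "k < N")
    case True
    then have "dual_pairing (lev E k) (lev E (Suc k)) (pr E k)"
      using E by (simp add: iterated_dual_def)
    then show ?thesis
      using True
      by (auto simp: dual_pairing_def lev'_def pr'_def sub' bf' ball' image_image scaleC_prod_def
          norm0)
  next
    case False
    then have k: "k = N" using that by simp
    have "csubspace ({0 :: 'u} \<times> \<beta> ` P)"
      unfolding complex_vector.subspace_def
      by (auto simp: scaleC_prod_def zero_prod_def simp flip: \<beta>add \<beta>scale \<beta>0
          intro: Padd Pscale P0 imageI)
    moreover have "bounded_functional_on X (\<lambda>x. q (\<beta> \<phi>) x)" if "\<phi> \<in> P" for \<phi>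
      using P_cong[of "q (\<beta> \<phi>)" \<phi>] q that by (auto simp: PX)
    moreover have "norm (\<beta> \<phi>) = (SUP x \<in> {x \<in> X. norm x \<le> 1}. cmod (q (\<beta> \<phi>) x))" if "\<phi> \<in> P" for \<phi>
      unfolding \<beta>norm[OF that] using that by (intro SUP_cong) (auto simp: q)
    moreover have "\<exists>\<psi> \<in> P. \<forall>x \<in> X. q (\<beta> \<psi>) x = \<phi> (x, 0)"
      if "bounded_functional_on X (\<lambda>x. \<phi> (x, 0))" for \<phi> :: "_ \<Rightarrow> complex"
      using that by (intro bexI[of _ "\<lambda>x. \<phi> (x, 0)"]) (auto simp: q PX)
    ultimately show ?thesis
      using k X
      by (auto simp: dual_pairing_def lev'_def pr'_def sub' bf' ball' image_image scaleC_prod_def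
          norm0 q Padd Pscale simp flip: \<beta>add \<beta>scale X_def)
  qed
  moreover have "clinear (emb E')"
  proof -
    have "clinear (emb E)" using E by (simp add: iterated_dual_def)
    then show ?thesis
      by (auto simp: E'_def Vector_Spaces.linear_def module_hom_def module_hom_axioms_def
          scaleC_prod_def complex_vector.vector_space_axioms complex_vector.module_axioms)
  qed
  moreover have "range (emb E') = lev' 0" "\<forall>x. norm (emb E' x) = infdist x J"
    using E by (auto simp: E'_def iterated_dual_def lev'_def norm0)
  ultimately have "iterated_dual (Suc N) J E'"
    by (simp add: iterated_dual_def E'_def)
  then show ?thesis ..
qed

end

theory Submission
  imports Defs
begin

text \<open>
  Passing to the \<open>2n\<close>-th dual is a functor, so the projections and injections of \<open>T = A \<oplus> M \<oplus> B\<close>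
  split \<open>T\<^sup>(\<^sup>2\<^sup>n\<^sup>)\<close> into \<open>A\<^sup>(\<^sup>2\<^sup>n\<^sup>) \<oplus> M\<^sup>(\<^sup>2\<^sup>n\<^sup>) \<oplus> B\<^sup>(\<^sup>2\<^sup>n\<^sup>)\<close> with the matrix-like action. Nondegeneracy makes a
  module derivation \<open>D\<close> of \<open>T\<close> upper triangular: its diagonal triangular_entries are module derivations of \<open>A\<close>
  and \<open>B\<close>, hence inner, and a bounded approximate identity \<open>e\<close> of \<open>A\<close> (or of \<open>B\<close>) yields, as a weak*
  cluster point \<open>y\<close> of the corner of \<open>D e\<close>, the part \<open>a \<cdot> y - y \<cdot> b\<close> of the corner coming from the
  diagonal. What remains of \<open>D\<close> modulo inner derivations is \<open>\<phi>\<close> in the corner for a module homomorphism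
  \<open>\<phi> : M \<rightarrow> M\<^sup>(\<^sup>2\<^sup>n\<^sup>)\<close>, and this derivation is inner exactly if \<open>\<phi>\<close> is some \<open>\<rho>\<^sub>x\<^sub>,\<^sub>z\<close> with central \<open>x\<close>, \<open>z\<close>.
\<close>

section \<open>Bounded complex-linear maps between subspaces\<close>

text \<open>Domain and codomain are sets because the levels of a tower are mere subsets of a
  container. The constant stays explicit: transposes preserve it, and this later bounds
  \<open>extA m x\<close> and \<open>extB m z\<close> uniformly in m.\<close>

definition bounded_clinear_on ::
  "'u::complex_normed_vector set \<Rightarrow> 'v::complex_normed_vector set \<Rightarrow> real \<Rightarrow> ('u \<Rightarrow> 'v) \<Rightarrow> bool" where
  "bounded_clinear_on X Y K T \<longleftrightarrow>
     (\<forall>x \<in> X. T x \<in> Y \<and> norm (T x) \<le> K * norm x) \<and> 0 \<le> K \<and>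
     (\<forall>x \<in> X. \<forall>y \<in> X. T (x + y) = T x + T y) \<and>
     (\<forall>c. \<forall>x \<in> X. T (c *\<^sub>C x) = c *\<^sub>C T x)"

text \<open>Hides the constant, so that boundedness of composite maps can be settled by
  simplification.\<close>

definition bounded_clinear ::
  "('u::complex_normed_vector \<Rightarrow> 'v::complex_normed_vector) \<Rightarrow> bool" where
  "bounded_clinear S \<longleftrightarrow> (\<exists>K. bounded_clinear_on UNIV UNIV K S)"

lemma scaleC_minus_one: "(- 1) *\<^sub>C x = - (x :: 'a::complex_vector)"
  by (simp add: complex_vector.scale_minus_left scaleC_one)

lemma bounded_clinear_on_add:
  assumes "bounded_clinear_on X Y K T" and "bounded_clinear_on X Y L R" and "csubspace Y"
  shows "bounded_clinear_on X Y (K + L) (\<lambda>x. T x + R x)"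
proof -
  have "norm (T x + R x) \<le> (K + L) * norm x" if "x \<in> X" for x
    using assms(1,2) that norm_triangle_mono[of "T x" "K * norm x" "R x" "L * norm x"]
    by (simp add: bounded_clinear_on_def distrib_right)
  then show ?thesis
    using assms
    by (auto simp: bounded_clinear_on_def complex_vector.subspace_add scaleC_add_right)
qed

lemma bounded_clinear_on_comp:
  assumes "bounded_clinear_on X Y K T" and "bounded_clinear_on Y Z L R"
  shows "bounded_clinear_on X Z (L * K) (\<lambda>x. R (T x))"
proof -
  have "norm (R (T x)) \<le> L * K * norm x" if "x \<in> X" for x
  proof -
    have "norm (R (T x)) \<le> L * norm (T x)"
      using assms that by (auto simp: bounded_clinear_on_def)
    also have "\<dots> \<le> L * (K * norm x)"
      using assms that by (auto simp: bounded_clinear_on_def intro: mult_left_mono)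
    finally show ?thesis by (simp add: mult.assoc)
  qed
  then show ?thesis
    using assms by (auto simp: bounded_clinear_on_def)
qed

lemma bounded_clinear_add:
  assumes "bounded_clinear S" "bounded_clinear R" shows "bounded_clinear (\<lambda>x. S x + R x)"
  using assms bounded_clinear_on_add[OF _ _ complex_vector.subspace_UNIV]
  unfolding bounded_clinear_def by blast

lemma bounded_clinear_comp:
  assumes "bounded_clinear S" "bounded_clinear R" shows "bounded_clinear (\<lambda>x. R (S x))"
  using assms bounded_clinear_on_comp unfolding bounded_clinear_def by blast

lemma bounded_clinear_id: "bounded_clinear (\<lambda>x. x)"
  unfolding bounded_clinear_def by (rule exI[of _ 1]) (simp add: bounded_clinear_on_def)

lemma bounded_clinear_on_zero: "bounded_clinear_on UNIV UNIV 0 (\<lambda>x. 0)"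
  by (simp add: bounded_clinear_on_def)

lemma bounded_clinear_zero: "bounded_clinear (\<lambda>x. 0)"
  using bounded_clinear_on_zero bounded_clinear_def by blast

section \<open>Dual pairings and transposes\<close>

context
  fixes X :: "'u::complex_normed_vector set" and Y :: "'v::complex_normed_vector set" and p
  assumes dp: "dual_pairing X Y p"
begin

lemma pairing_functional: "f \<in> Y \<Longrightarrow> bounded_functional_on X (p f)"
  and pairing_surj: "bounded_functional_on X \<phi> \<Longrightarrow> \<exists>f \<in> Y. \<forall>x \<in> X. p f x = \<phi> x"
  and pairing_add_left: "f \<in> Y \<Longrightarrow> g \<in> Y \<Longrightarrow> x \<in> X \<Longrightarrow> p (f + g) x = p f x + p g x"
  and pairing_scale_left: "f \<in> Y \<Longrightarrow> x \<in> X \<Longrightarrow> p (c *\<^sub>C f) x = c * p f x"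
  and pairing_norm: "f \<in> Y \<Longrightarrow> norm f = (SUP x \<in> {x \<in> X. norm x \<le> 1}. cmod (p f x))"
  and pairing_subspaces: "csubspace X" "csubspace Y"
  using dp by (simp_all add: dual_pairing_def)

lemma pairing_add_right: "f \<in> Y \<Longrightarrow> x \<in> X \<Longrightarrow> y \<in> X \<Longrightarrow> p f (x + y) = p f x + p f y"
  and pairing_scale_right: "f \<in> Y \<Longrightarrow> x \<in> X \<Longrightarrow> p f (c *\<^sub>C x) = c * p f x"
  using pairing_functional by (simp_all add: bounded_functional_on_def)

text \<open>The norm of f is given only as a supremum over the unit ball. Rescaling x to norm one
  moves it into the ball, and boundedness of the functional makes the supremum an upper
  bound.\<close>

lemma pairing_bound:
  assumes f: "f \<in> Y" and x: "x \<in> X"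
  shows "cmod (p f x) \<le> norm f * norm x"
proof (cases "x = 0")
  case True
  then have "p f x = 0"
    using pairing_scale_right[OF f x, of 0] by simp
  then show ?thesis by simp
next
  case False
  let ?c = "complex_of_real (inverse (norm x))"
  obtain K where K: "\<And>x. x \<in> X \<Longrightarrow> cmod (p f x) \<le> K * norm x"
    using pairing_functional[OF f] unfolding bounded_functional_on_def by blast
  have "cmod (p f x) \<le> \<bar>K\<bar>" if "x \<in> X" "norm x \<le> 1" for x
  proof -
    have "K * norm x \<le> \<bar>K\<bar> * 1"
      using that by (intro mult_mono) auto
    then show ?thesis using K[OF that(1)] by simp
  qed
  then have bdd: "bdd_above ((\<lambda>x. cmod (p f x)) ` {x \<in> X. norm x \<le> 1})"
    by (auto simp: bdd_above_def)
  have "?c *\<^sub>C x \<in> X"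
    by (rule complex_vector.subspace_scale[OF pairing_subspaces(1) x])
  moreover have "norm (?c *\<^sub>C x) = 1"
    using False by (simp add: norm_scaleC norm_inverse)
  ultimately have "cmod (p f (?c *\<^sub>C x)) \<le> norm f"
    unfolding pairing_norm[OF f] by (intro cSUP_upper bdd) auto
  then show ?thesis
    using False by (simp add: pairing_scale_right[OF f x] norm_mult norm_inverse)
      (simp add: field_simps)
qed

lemma pairing_norm_le:
  assumes f: "f \<in> Y" and K: "0 \<le> K" "\<And>x. x \<in> X \<Longrightarrow> cmod (p f x) \<le> K * norm x"
  shows "norm f \<le> K"
  unfolding pairing_norm[OF f]
proof (rule cSUP_least)
  show "{x \<in> X. norm x \<le> 1} \<noteq> {}"
    using complex_vector.subspace_0[OF pairing_subspaces(1)] by force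
  fix x assume x: "x \<in> {x \<in> X. norm x \<le> 1}"
  then have "cmod (p f x) \<le> K * norm x" using K by simp
  also have "\<dots> \<le> K * 1" using x K by (intro mult_left_mono) auto
  finally show "cmod (p f x) \<le> K" by simp
qed

text \<open>The pairing is isometric, so a difference that annihilates X has norm zero. This is the
  uniqueness behind the definite description in \<open>dual_map\<close>.\<close>

lemma pairing_eqI:
  assumes f: "f \<in> Y" and g: "g \<in> Y" and eq: "\<And>x. x \<in> X \<Longrightarrow> p f x = p g x"
  shows "f = g"
proof -
  have g': "(- 1) *\<^sub>C g \<in> Y"
    by (rule complex_vector.subspace_scale[OF pairing_subspaces(2) g])
  have "f + (- 1) *\<^sub>C g \<in> Y"
    by (rule complex_vector.subspace_add[OF pairing_subspaces(2) f g'])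
  then have "norm (f + (- 1) *\<^sub>C g) \<le> 0"
  proof (rule pairing_norm_le)
    fix x assume x: "x \<in> X"
    show "cmod (p (f + (- 1) *\<^sub>C g) x) \<le> 0 * norm x"
      unfolding pairing_add_left[OF f g' x] pairing_scale_left[OF g x] by (simp add: eq[OF x])
  qed simp
  then show ?thesis by (simp add: scaleC_minus_one)
qed

end

section \<open>Transposes and their functoriality\<close>

context
  fixes E :: "('x, 'u::complex_normed_vector) dual_tower"
    and F :: "('y, 'v::complex_normed_vector) dual_tower" and k :: nat
  assumes dpE: "dual_pairing (lev E k) (lev E (Suc k)) (pr E k)"
    and dpF: "dual_pairing (lev F k) (lev F (Suc k)) (pr F k)"
begin

lemma dual_map_eq:
  assumes "g \<in> lev E (Suc k)" and "\<And>x. x \<in> lev E k \<Longrightarrow> pr E k g x = pr F k f (T x)"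
  shows "dual_map E F k T f = g"
  unfolding dual_map_def
  by (rule the_equality) (use assms in \<open>auto intro: pairing_eqI[OF dpE]\<close>)

text \<open>The functional \<open>pr F k f\<close> composed with T is bounded, and every bounded
  functional is represented in the next level, so the definite description denotes.\<close>

lemma dual_map_char:
  assumes T: "bounded_clinear_on (lev E k) (lev F k) K T" and f: "f \<in> lev F (Suc k)"
  shows "dual_map E F k T f \<in> lev E (Suc k)"
    and "x \<in> lev E k \<Longrightarrow> pr E k (dual_map E F k T f) x = pr F k f (T x)"
proof -
  have "cmod (pr F k f (T x)) \<le> (norm f * K) * norm x" if "x \<in> lev E k" for x
  proof -
    have "cmod (pr F k f (T x)) \<le> norm f * norm (T x)"
      using T that by (intro pairing_bound[OF dpF f]) (auto simp: bounded_clinear_on_def)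
    also have "\<dots> \<le> norm f * (K * norm x)"
      using T that by (intro mult_left_mono) (auto simp: bounded_clinear_on_def)
    finally show ?thesis by (simp add: mult.assoc)
  qed
  then have "bounded_functional_on (lev E k) (\<lambda>x. pr F k f (T x))"
    using T f unfolding bounded_functional_on_def
    by (auto simp: bounded_clinear_on_def pairing_add_right[OF dpF] pairing_scale_right[OF dpF])
  then obtain g where g: "g \<in> lev E (Suc k)" "\<forall>x \<in> lev E k. pr E k g x = pr F k f (T x)"
    using pairing_surj[OF dpE] by blast
  then have "dual_map E F k T f = g"
    by (intro dual_map_eq) auto
  then show "dual_map E F k T f \<in> lev E (Suc k)"
    and "x \<in> lev E k \<Longrightarrow> pr E k (dual_map E F k T f) x = pr F k f (T x)"
    using g by auto
qed

lemma dual_map_bounded: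
  assumes T: "bounded_clinear_on (lev E k) (lev F k) K T"
  shows "bounded_clinear_on (lev F (Suc k)) (lev E (Suc k)) K (dual_map E F k T)"
proof -
  note [simp] = dual_map_char[OF T]
  have Tx: "T x \<in> lev F k" "norm (T x) \<le> K * norm x" if "x \<in> lev E k" for x
    using T that by (auto simp: bounded_clinear_on_def)
  have K: "0 \<le> K" using T by (simp add: bounded_clinear_on_def)
  have "norm (dual_map E F k T f) \<le> K * norm f" if f: "f \<in> lev F (Suc k)" for f
  proof (rule pairing_norm_le[OF dpE])
    fix x assume x: "x \<in> lev E k"
    have "cmod (pr F k f (T x)) \<le> norm f * norm (T x)"
      by (rule pairing_bound[OF dpF f Tx(1)[OF x]])
    also have "\<dots> \<le> norm f * (K * norm x)"
      using Tx[OF x] by (intro mult_left_mono) auto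
    finally show "cmod (pr E k (dual_map E F k T f) x) \<le> K * norm f * norm x"
      using f x by (simp add: mult_ac)
  qed (use f K in auto)
  moreover have "dual_map E F k T (f + g) = dual_map E F k T f + dual_map E F k T g"
    if "f \<in> lev F (Suc k)" "g \<in> lev F (Suc k)" for f g
    using that by (intro dual_map_eq)
      (auto simp: Tx pairing_add_left[OF dpE] pairing_add_left[OF dpF]
        complex_vector.subspace_add[OF pairing_subspaces(2)[OF dpE]])
  moreover have "dual_map E F k T (c *\<^sub>C f) = c *\<^sub>C dual_map E F k T f"
    if "f \<in> lev F (Suc k)" for c f
    using that by (intro dual_map_eq)
      (auto simp: Tx pairing_scale_left[OF dpE] pairing_scale_left[OF dpF]
        complex_vector.subspace_scale[OF pairing_subspaces(2)[OF dpE]])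
  ultimately show ?thesis
    using K by (auto simp: bounded_clinear_on_def)
qed

lemma dual_map_add:
  assumes T: "bounded_clinear_on (lev E k) (lev F k) K T"
    and R: "bounded_clinear_on (lev E k) (lev F k) L R" and f: "f \<in> lev F (Suc k)"
  shows "dual_map E F k (\<lambda>x. T x + R x) f = dual_map E F k T f + dual_map E F k R f"
  using f T R by (intro dual_map_eq)
    (auto simp: dual_map_char[OF T] dual_map_char[OF R] pairing_add_left[OF dpE]
      pairing_add_right[OF dpF] bounded_clinear_on_def
      complex_vector.subspace_add[OF pairing_subspaces(2)[OF dpE]])

end

lemma dual_map_comp:
  assumes dpE: "dual_pairing (lev E k) (lev E (Suc k)) (pr E k)"
    and dpF: "dual_pairing (lev F k) (lev F (Suc k)) (pr F k)"
    and dpG: "dual_pairing (lev G k) (lev G (Suc k)) (pr G k)"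
    and T: "bounded_clinear_on (lev E k) (lev F k) K T"
    and R: "bounded_clinear_on (lev F k) (lev G k) L R" and f: "f \<in> lev G (Suc k)"
  shows "dual_map E F k T (dual_map F G k R f) = dual_map E G k (\<lambda>x. R (T x)) f"
  using f T by (intro dual_map_eq[OF dpE dpG, symmetric])
    (auto simp: dual_map_char[OF dpE dpF T] dual_map_char[OF dpF dpG R] bounded_clinear_on_def)

text \<open>Maps are total on the container and may differ off the level. This lets identities known
  only on a level pass through a transpose.\<close>

lemma dual_map_cong:
  assumes "\<And>x. x \<in> lev E k \<Longrightarrow> T x = R x"
  shows "dual_map E F k T = dual_map E F k R"
  using assms by (auto simp: dual_map_def fun_eq_iff)

lemma dual_map_id:
  assumes "dual_pairing (lev E k) (lev E (Suc k)) (pr E k)" and "f \<in> lev E (Suc k)"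
  shows "dual_map E E k (\<lambda>x. x) f = f"
  using assms by (intro dual_map_eq) auto

section \<open>Iterated biduals of bounded maps\<close>

text \<open>The functor \<open>S \<mapsto> S\<^sup>(\<^sup>2\<^sup>k\<^sup>)\<close>, of which the actions on even duals and the maps \<open>\<lambda> \<mapsto> \<lambda> \<cdot> m\<close>,
  \<open>\<mu> \<mapsto> m \<cdot> \<mu>\<close> are all values.\<close>

primrec bidual ::
  "('x, 'u) dual_tower \<Rightarrow> ('y, 'v) dual_tower \<Rightarrow> ('x \<Rightarrow> 'y) \<Rightarrow> nat \<Rightarrow> 'u \<Rightarrow> 'v" where
  "bidual E F S 0 = base_map E F S"
| "bidual E F S (Suc k) = dual_map F E (2 * k + 1) (dual_map E F (2 * k) (bidual E F S k))"

lemma iterated_dual_map_even: "iterated_dual_map E S (2 * k) = bidual E E S k"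
  by (induction k) simp_all

lemma ext_left_bidual: "ext_left EA EM act m k = bidual EA EM (\<lambda>a. act a m) k"
  by (induction k) simp_all

lemma ext_right_bidual: "ext_right EB EM act m k = bidual EB EM (act m) k"
  by (induction k) simp_all

lemma iterated_dual_pairing:
  "iterated_dual N J E \<Longrightarrow> k < N \<Longrightarrow> dual_pairing (lev E k) (lev E (Suc k)) (pr E k)"
  by (simp add: iterated_dual_def)

text \<open>For J = {0} the distance to J is the norm, so \<open>emb E\<close> is isometric;
  injectivity follows by applying the norm to a difference.\<close>

lemma iterated_dual_emb:
  fixes E :: "('x::complex_normed_vector, 'u::complex_normed_vector) dual_tower"
  assumes "iterated_dual N {0} E"
  shows "emb E (x + y) = emb E x + emb E y" and "emb E (c *\<^sub>C x) = c *\<^sub>C emb E x"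
    and "norm (emb E x) = norm x" and "inj (emb E)" and "lev E 0 = range (emb E)"
proof -
  have hom: "module_hom scaleC scaleC (emb E)"
    using assms by (simp add: iterated_dual_def Vector_Spaces.linear_def)
  then show add: "emb E (x + y) = emb E x + emb E y" and sc: "emb E (c *\<^sub>C x) = c *\<^sub>C emb E x"
    for x y c
    by (simp_all add: module_hom.add module_hom.scale)
  show norm: "norm (emb E x) = norm x" for x
    using assms by (simp add: iterated_dual_def)
  show "inj (emb E)"
  proof (rule injI)
    fix x y assume "emb E x = emb E y"
    then have "norm (emb E (x + (- 1) *\<^sub>C y)) = 0"
      unfolding add sc by (simp add: scaleC_minus_one)
    then show "x = y" by (simp add: norm scaleC_minus_one)
  qed
  show "lev E 0 = range (emb E)"
    using assms by (simp add: iterated_dual_def)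
qed

lemma base_map_emb:
  fixes E :: "('x::complex_normed_vector, 'u::complex_normed_vector) dual_tower"
  assumes "iterated_dual N {0} E"
  shows "base_map E F S (emb E x) = emb F (S x)"
  by (simp add: base_map_def inv_f_f iterated_dual_emb(4)[OF assms])

context
  fixes E :: "('x::complex_normed_vector, 'u::complex_normed_vector) dual_tower"
    and F :: "('y::complex_normed_vector, 'v::complex_normed_vector) dual_tower" and N :: nat
  assumes E: "iterated_dual N {0} E" and F: "iterated_dual N {0} F"
begin

text \<open>Each induction step takes two transposes, and neither changes \<open>K\<close>.\<close>

lemma bidual_bounded_on:
  assumes S: "bounded_clinear_on UNIV UNIV K S"
  shows "2 * k \<le> N \<Longrightarrow> bounded_clinear_on (lev E (2 * k)) (lev F (2 * k)) K (bidual E F S k)"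
proof (induction k)
  case 0
  show ?case
    using S
    by (auto simp: bounded_clinear_on_def iterated_dual_emb[OF E] iterated_dual_emb(3,5)[OF F]
        base_map_emb[OF E] simp flip: iterated_dual_emb(1,2)[OF E] iterated_dual_emb(1,2)[OF F])
next
  case (Suc k)
  then have "bounded_clinear_on (lev E (2 * k)) (lev F (2 * k)) K (bidual E F S k)" by simp
  then have "bounded_clinear_on (lev F (Suc (2 * k))) (lev E (Suc (2 * k))) K
      (dual_map E F (2 * k) (bidual E F S k))"
    using Suc.prems by (intro dual_map_bounded[OF iterated_dual_pairing[OF E] iterated_dual_pairing[OF F]]) auto
  then have "bounded_clinear_on (lev E (Suc (Suc (2 * k)))) (lev F (Suc (Suc (2 * k)))) K
      (dual_map F E (Suc (2 * k)) (dual_map E F (2 * k) (bidual E F S k)))"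
    using Suc.prems by (intro dual_map_bounded[OF iterated_dual_pairing[OF F] iterated_dual_pairing[OF E]]) auto
  then show ?case by simp
qed

text \<open>The induction hypothesis holds only on the even level, so \<open>dual_map_cong\<close>
  carries it first to the odd level and then to the next even one.\<close>

lemma bidual_add:
  assumes S: "bounded_clinear S" and R: "bounded_clinear R"
  shows "2 * k \<le> N \<Longrightarrow> \<xi> \<in> lev E (2 * k) \<Longrightarrow>
    bidual E F (\<lambda>x. S x + R x) k \<xi> = bidual E F S k \<xi> + bidual E F R k \<xi>"
proof (induction k arbitrary: \<xi>)
  case 0
  then show ?case
    by (auto simp: iterated_dual_emb[OF E] base_map_emb[OF E] iterated_dual_emb(1)[OF F])
next
  case (Suc k)
  obtain K L where K: "bounded_clinear_on UNIV UNIV K S" and L: "bounded_clinear_on UNIV UNIV L R"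
    using S R unfolding bounded_clinear_def by blast
  have dp: "dual_pairing (lev E j) (lev E (Suc j)) (pr E j)"
      "dual_pairing (lev F j) (lev F (Suc j)) (pr F j)" if "j \<le> Suc (2 * k)" for j
    using that Suc.prems by (auto intro!: iterated_dual_pairing[OF E] iterated_dual_pairing[OF F])
  have b: "bounded_clinear_on (lev E (2 * k)) (lev F (2 * k)) K (bidual E F S k)"
    "bounded_clinear_on (lev E (2 * k)) (lev F (2 * k)) L (bidual E F R k)"
    using Suc.prems by (auto intro!: bidual_bounded_on K L)
  have d: "bounded_clinear_on (lev F (Suc (2 * k))) (lev E (Suc (2 * k))) K
      (dual_map E F (2 * k) (bidual E F S k))"
    "bounded_clinear_on (lev F (Suc (2 * k))) (lev E (Suc (2 * k))) L
      (dual_map E F (2 * k) (bidual E F R k))"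
    using b by (auto intro!: dual_map_bounded dp)
  have "dual_map E F (2 * k) (bidual E F (\<lambda>x. S x + R x) k) f =
      dual_map E F (2 * k) (bidual E F S k) f + dual_map E F (2 * k) (bidual E F R k) f"
    if "f \<in> lev F (Suc (2 * k))" for f
    using Suc.prems that
    by (subst dual_map_cong[where R = "\<lambda>\<xi>. bidual E F S k \<xi> + bidual E F R k \<xi>"])
      (auto intro: Suc.IH dual_map_add[OF dp b])
  then have "bidual E F (\<lambda>x. S x + R x) (Suc k) = dual_map F E (Suc (2 * k))
      (\<lambda>f. dual_map E F (2 * k) (bidual E F S k) f + dual_map E F (2 * k) (bidual E F R k) f)"
    by (auto intro: dual_map_cong)
  then show ?case
    using Suc.prems by (simp add: dual_map_add[OF dp(2,1) d])
qed

end

text \<open>One transpose reverses composition and the second restores the order. This covariance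
  turns identities between module actions into identities between their biduals.\<close>

lemma bidual_comp:
  fixes E :: "('x::complex_normed_vector, 'u::complex_normed_vector) dual_tower"
    and F :: "('y::complex_normed_vector, 'v::complex_normed_vector) dual_tower"
    and G :: "('z::complex_normed_vector, 'w::complex_normed_vector) dual_tower"
  assumes E: "iterated_dual N {0} E" and F: "iterated_dual N {0} F" and G: "iterated_dual N {0} G"
    and S: "bounded_clinear S" and R: "bounded_clinear R"
  shows "2 * k \<le> N \<Longrightarrow> \<xi> \<in> lev E (2 * k) \<Longrightarrow>
    bidual F G R k (bidual E F S k \<xi>) = bidual E G (\<lambda>x. R (S x)) k \<xi>"
proof (induction k arbitrary: \<xi>)
  case 0
  then show ?case
    by (auto simp: iterated_dual_emb[OF E] base_map_emb[OF E] base_map_emb[OF F])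
next
  case (Suc k)
  obtain K L where K: "bounded_clinear_on UNIV UNIV K S" and L: "bounded_clinear_on UNIV UNIV L R"
    using S R unfolding bounded_clinear_def by blast
  have dp: "dual_pairing (lev E j) (lev E (Suc j)) (pr E j)"
      "dual_pairing (lev F j) (lev F (Suc j)) (pr F j)"
      "dual_pairing (lev G j) (lev G (Suc j)) (pr G j)" if "j \<le> Suc (2 * k)" for j
    using that Suc.prems
    by (auto intro!: iterated_dual_pairing[OF E] iterated_dual_pairing[OF F] iterated_dual_pairing[OF G])
  have b: "bounded_clinear_on (lev E (2 * k)) (lev F (2 * k)) K (bidual E F S k)"
    "bounded_clinear_on (lev F (2 * k)) (lev G (2 * k)) L (bidual F G R k)"
    using Suc.prems by (auto intro!: bidual_bounded_on[OF E F] bidual_bounded_on[OF F G] K L)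
  have d: "bounded_clinear_on (lev F (Suc (2 * k))) (lev E (Suc (2 * k))) K
      (dual_map E F (2 * k) (bidual E F S k))"
    "bounded_clinear_on (lev G (Suc (2 * k))) (lev F (Suc (2 * k))) L
      (dual_map F G (2 * k) (bidual F G R k))"
    using b by (auto intro!: dual_map_bounded dp)
  have "dual_map E G (2 * k) (bidual E G (\<lambda>x. R (S x)) k) f =
      dual_map E F (2 * k) (bidual E F S k) (dual_map F G (2 * k) (bidual F G R k) f)"
    if "f \<in> lev G (Suc (2 * k))" for f
    using Suc.prems that
    by (subst dual_map_cong[where R = "\<lambda>\<xi>. bidual F G R k (bidual E F S k \<xi>)"])
      (auto simp: Suc.IH dual_map_comp[OF dp b])
  then have "bidual E G (\<lambda>x. R (S x)) (Suc k) = dual_map G E (Suc (2 * k))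
      (\<lambda>f. dual_map E F (2 * k) (bidual E F S k) (dual_map F G (2 * k) (bidual F G R k) f))"
    by (auto intro: dual_map_cong)
  then show ?case
    using Suc.prems by (simp add: dual_map_comp[OF dp(3,2,1) d(2,1)])
qed

lemma bidual_id:
  fixes E :: "('x::complex_normed_vector, 'u::complex_normed_vector) dual_tower"
  assumes E: "iterated_dual N {0} E"
  shows "2 * k \<le> N \<Longrightarrow> \<xi> \<in> lev E (2 * k) \<Longrightarrow> bidual E E (\<lambda>x. x) k \<xi> = \<xi>"
proof (induction k arbitrary: \<xi>)
  case 0
  then show ?case
    by (auto simp: iterated_dual_emb[OF E] base_map_emb[OF E])
next
  case (Suc k)
  have dp: "dual_pairing (lev E j) (lev E (Suc j)) (pr E j)" if "j \<le> Suc (2 * k)" for j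
    using that Suc.prems by (auto intro!: iterated_dual_pairing[OF E])
  have "dual_map E E (2 * k) (bidual E E (\<lambda>x. x) k) f = f"
    if "f \<in> lev E (Suc (2 * k))" for f
    using Suc.prems that
    by (subst dual_map_cong[where R = "\<lambda>\<xi>. \<xi>"]) (auto simp: Suc.IH intro: dual_map_id[OF dp])
  then have "bidual E E (\<lambda>x. x) (Suc k) = dual_map E E (Suc (2 * k)) (\<lambda>f. f)"
    by (auto intro: dual_map_cong)
  then show ?case
    using Suc.prems by (simp add: dual_map_id[OF dp])
qed

lemma iterated_dual_subspace:
  assumes "iterated_dual N J E" and "0 < k" and "k \<le> N"
  shows "csubspace (lev E k)"
  using pairing_subspaces(2)[OF iterated_dual_pairing[OF assms(1), of "k - 1"]] assms by simp

context
  fixes E :: "('x::complex_normed_vector, 'u::complex_normed_vector) dual_tower"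
    and F :: "('y::complex_normed_vector, 'v::complex_normed_vector) dual_tower" and k :: nat
  assumes E: "iterated_dual (2 * k) {0} E" and F: "iterated_dual (2 * k) {0} F"
begin

lemma bidual_zero_map: "\<xi> \<in> lev E (2 * k) \<Longrightarrow> bidual E F (\<lambda>x. 0) k \<xi> = 0"
  using bidual_bounded_on[OF E F bounded_clinear_on_zero, of k] by (simp add: bounded_clinear_on_def)

context
  fixes S :: "'x \<Rightarrow> 'y"
  assumes S: "bounded_clinear S"
begin

lemma bidual_mem: "\<xi> \<in> lev E (2 * k) \<Longrightarrow> bidual E F S k \<xi> \<in> lev F (2 * k)"
    and bidual_plus: "\<xi> \<in> lev E (2 * k) \<Longrightarrow> \<eta> \<in> lev E (2 * k) \<Longrightarrow>
      bidual E F S k (\<xi> + \<eta>) = bidual E F S k \<xi> + bidual E F S k \<eta>"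
    and bidual_scaleC: "\<xi> \<in> lev E (2 * k) \<Longrightarrow>
      bidual E F S k (c *\<^sub>C \<xi>) = c *\<^sub>C bidual E F S k \<xi>"
    and bidual_bound: "\<exists>K. \<forall>\<xi> \<in> lev E (2 * k). norm (bidual E F S k \<xi>) \<le> K * norm \<xi>"
proof -
  obtain K where "bounded_clinear_on UNIV UNIV K S"
    using S unfolding bounded_clinear_def by blast
  then have "bounded_clinear_on (lev E (2 * k)) (lev F (2 * k)) K (bidual E F S k)"
    by (intro bidual_bounded_on[OF E F]) auto
  then show "\<xi> \<in> lev E (2 * k) \<Longrightarrow> bidual E F S k \<xi> \<in> lev F (2 * k)"
    and "\<xi> \<in> lev E (2 * k) \<Longrightarrow> \<eta> \<in> lev E (2 * k) \<Longrightarrow>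
      bidual E F S k (\<xi> + \<eta>) = bidual E F S k \<xi> + bidual E F S k \<eta>"
    and "\<xi> \<in> lev E (2 * k) \<Longrightarrow> bidual E F S k (c *\<^sub>C \<xi>) = c *\<^sub>C bidual E F S k \<xi>"
    and "\<exists>K. \<forall>\<xi> \<in> lev E (2 * k). norm (bidual E F S k \<xi>) \<le> K * norm \<xi>"
    for \<xi> \<eta> c
    by (auto simp: bounded_clinear_on_def)
qed

end

end

section \<open>Weak* limits, additive maps and quotient spaces\<close>

text \<open>The net \<open>\<delta>\<close> itself need not converge. A single y reproduces all
  scalar limits that happen to exist, which is enough to identify its images under transposed
  operators.\<close>

lemma weak_star_cluster_point:
  assumes dp: "dual_pairing X Y p" and F: "F \<noteq> bot"
    and ev: "\<forall>\<^sub>F e in F. \<delta> e \<in> Y \<and> norm (\<delta> e) \<le> K"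
  obtains y where "y \<in> Y" and "\<And>x l. x \<in> X \<Longrightarrow> ((\<lambda>e. p (\<delta> e) x) \<longlongrightarrow> l) F \<Longrightarrow> p y x = l"
proof -
  \<comment> \<open>Alaoglu's argument: functionals bounded by \<open>K\<close> lie in a product of discs, compact by Tychonoff.\<close>
  define \<Phi> where "\<Phi> e x = (if x \<in> X then p (\<delta> e) x else 0)" for e x
  define H where "H = filtermap \<Phi> F"
  define C where "C = Pi UNIV (\<lambda>x. if x \<in> X then cball (0::complex) (K * norm x) else {0})"
  have "compactin (product_topology (\<lambda>_. euclidean) UNIV)
      (PiE UNIV (\<lambda>x. if x \<in> X then cball (0::complex) (K * norm x) else {0}))"
    by (subst compactin_PiE) auto
  then have "compact C"
    by (simp add: C_def PiE_UNIV_domain euclidean_product_topology)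
  moreover have "H \<noteq> bot"
    using F by (simp add: H_def filtermap_bot_iff)
  moreover have "cmod (p (\<delta> e) x) \<le> K * norm x"
    if "\<delta> e \<in> Y" "norm (\<delta> e) \<le> K" "x \<in> X" for e x
    using pairing_bound[OF dp that(1,3)] that(2) by (meson mult_right_mono norm_ge_zero order_trans)
  then have "eventually (\<lambda>h. h \<in> C) H"
    unfolding H_def eventually_filtermap using ev
    by (auto elim!: eventually_mono simp: C_def \<Phi>_def)
  ultimately obtain g where g: "inf (nhds g) H \<noteq> bot"
    unfolding compact_filter by blast
  \<comment> \<open>\<open>U\<close> refines \<open>H\<close> and converges to the cluster point g:
    evaluations tend to g along \<open>U\<close>, while limits along F survive the
    refinement.\<close>
  define U where "U = inf (nhds g) H"
  have U: "U \<noteq> bot" using g by (simp add: U_def)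
  have lim: "((\<lambda>h. h x) \<longlongrightarrow> g x) U" for x
  proof -
    have "continuous_on UNIV (\<lambda>h::'a \<Rightarrow> complex. h x)"
      by (rule continuous_on_product_coordinates)
    then have "((\<lambda>h. h x) \<longlongrightarrow> g x) (at g within UNIV)"
      unfolding continuous_on_def by (rule bspec) simp
    then have "((\<lambda>h. h x) \<longlongrightarrow> g x) (nhds g)"
      by (rule tendsto_at_iff_tendsto_nhds[where g = "\<lambda>h. h x", THEN iffD1])
    then show ?thesis
      by (rule filterlim_mono) (simp_all add: U_def)
  qed
  \<comment> \<open>Properties of every admissible \<open>\<Phi> e\<close> hold eventually along
    \<open>U\<close>; thus g inherits additivity, homogeneity and the bound as limits.\<close>
  have evU: "\<forall>\<^sub>F h in U. Q h" if "\<And>e. \<delta> e \<in> Y \<Longrightarrow> norm (\<delta> e) \<le> K \<Longrightarrow> Q (\<Phi> e)" for Q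
  proof -
    have "\<forall>\<^sub>F h in H. Q h"
      unfolding H_def eventually_filtermap by (rule eventually_mono[OF ev]) (use that in auto)
    then show ?thesis
      by (rule filter_leD[rotated]) (simp add: U_def)
  qed
  have add: "g (x + y) = g x + g y" if "x \<in> X" "y \<in> X" for x y
  proof (rule tendsto_unique[OF U lim])
    show "((\<lambda>h. h (x + y)) \<longlongrightarrow> g x + g y) U"
      by (rule Lim_transform_eventually[OF tendsto_add[OF lim[of x] lim[of y]]], rule evU)
        (use that pairing_add_right[OF dp] complex_vector.subspace_add[OF pairing_subspaces(1)[OF dp]]
          in \<open>auto simp: \<Phi>_def\<close>)
  qed
  have scale: "g (c *\<^sub>C x) = c * g x" if "x \<in> X" for x c
  proof (rule tendsto_unique[OF U lim])
    show "((\<lambda>h. h (c *\<^sub>C x)) \<longlongrightarrow> c * g x) U"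
      by (rule Lim_transform_eventually[OF tendsto_mult_left[OF lim[of x]]], rule evU)
        (use that pairing_scale_right[OF dp] complex_vector.subspace_scale[OF pairing_subspaces(1)[OF dp]]
          in \<open>auto simp: \<Phi>_def\<close>)
  qed
  have bound: "cmod (g x) \<le> K * norm x" if x: "x \<in> X" for x
  proof (rule tendsto_upperbound[OF tendsto_norm[OF lim[of x]] _ U], rule evU)
    fix e assume "\<delta> e \<in> Y" "norm (\<delta> e) \<le> K"
    then show "cmod (\<Phi> e x) \<le> K * norm x"
      using pairing_bound[OF dp _ x, of "\<delta> e"] x
      by (simp add: \<Phi>_def) (meson mult_right_mono norm_ge_zero order_trans)
  qed
  have "bounded_functional_on X g"
    unfolding bounded_functional_on_def using add scale bound by blast
  then obtain y where y: "y \<in> Y" "\<forall>x \<in> X. p y x = g x"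
    using pairing_surj[OF dp] by blast
  show ?thesis
  proof (rule that[OF y(1)])
    fix x l assume x: "x \<in> X" and l: "((\<lambda>e. p (\<delta> e) x) \<longlongrightarrow> l) F"
    have "((\<lambda>h. h x) \<longlongrightarrow> l) H"
      using l x by (simp add: H_def filterlim_filtermap \<Phi>_def)
    then have "((\<lambda>h. h x) \<longlongrightarrow> l) U"
      by (rule filterlim_mono) (simp_all add: U_def)
    then show "p y x = l"
      using tendsto_unique[OF U lim] x y by auto
  qed
qed

section \<open>Continuity and boundedness of additive maps\<close>

text \<open>Module homomorphisms are assumed additive only, so scaling is available just for natural
  multiples. A crude bound with an additive error comes first, and natural multiples then remove the
  error.\<close>

lemma additive_continuous_bounded:
  fixes \<phi> :: "'a::real_normed_vector \<Rightarrow> 'b::real_normed_vector"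
  assumes add: "\<And>x y. \<phi> (x + y) = \<phi> x + \<phi> y" and cont: "continuous_on UNIV \<phi>"
  obtains K where "\<And>x. norm (\<phi> x) \<le> K * norm x"
proof -
  have zero: "\<phi> 0 = 0" using add[of 0 0] by simp
  have nat: "\<phi> (real j *\<^sub>R x) = real j *\<^sub>R \<phi> x" for j x
    by (induction j) (simp_all add: zero add scaleR_left_distrib)
  have "isCont \<phi> 0"
    using cont by (simp add: continuous_on_eq_continuous_at)
  then obtain d where d: "d > 0" "\<And>x. norm x < d \<Longrightarrow> norm (\<phi> x) < 1"
    using zero unfolding continuous_at_eps_delta
    by (auto simp: dist_norm dest: spec[of _ "1::real"])
  have unit: "norm (\<phi> x) \<le> norm x / d + 1" for x
  proof -
    \<comment> \<open>The successor makes j strictly larger than \<open>norm x / d\<close>, so x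
      divided by j lies in the open ball of radius d, at the cost of an excess of at most 1.\<close>
    define j where "j = Suc (nat \<lfloor>norm x / d\<rfloor>)"
    have "norm x / d < real j" "real j \<le> norm x / d + 1"
      using d(1) unfolding j_def by (auto simp: le_nat_floor) linarith+
    moreover have "0 < real j" by (simp add: j_def)
    ultimately have "norm (inverse (real j) *\<^sub>R x) < d"
      using d(1) by (simp add: field_simps)
    then have "norm (\<phi> (inverse (real j) *\<^sub>R x)) < 1"
      by (rule d(2))
    have scale: "real j *\<^sub>R inverse (real j) *\<^sub>R x = x"
      using \<open>0 < real j\<close> by simp
    have "norm (\<phi> x) = norm (\<phi> (real j *\<^sub>R inverse (real j) *\<^sub>R x))"
      unfolding scale ..
    also have "\<dots> = real j * norm (\<phi> (inverse (real j) *\<^sub>R x))"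
      unfolding nat by simp
    also have "\<dots> \<le> real j * 1"
      using \<open>norm (\<phi> (inverse (real j) *\<^sub>R x)) < 1\<close> by (intro mult_left_mono) auto
    finally have "norm (\<phi> x) \<le> real j" by simp
    then show ?thesis
      using \<open>real j \<le> norm x / d + 1\<close> by simp
  qed
  \<comment> \<open>Applying the crude bound to the j-fold multiple of x and dividing by j shrinks
    the error 1 to 1 / j.\<close>
  have "norm (\<phi> x) \<le> inverse d * norm x" for x
  proof (rule field_le_epsilon)
    fix e :: real assume e: "0 < e"
    obtain j where j: "1 / e < real j"
      using reals_Archimedean2 by blast
    then have pos: "0 < real j"
      using e by (meson less_trans zero_less_divide_1_iff)
    have "real j * norm (\<phi> x) \<le> real j * norm x / d + 1"
      using unit[of "real j *\<^sub>R x"] by (simp add: nat)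
    then have "norm (\<phi> x) \<le> inverse d * norm x + 1 / real j"
      using pos d(1) by (simp add: field_simps)
    moreover have "1 / real j \<le> e"
      using j e pos by (simp add: field_simps)
    ultimately show "norm (\<phi> x) \<le> inverse d * norm x + e" by simp
  qed
  then show ?thesis by (rule that)
qed

lemma bounded_additive_continuous:
  fixes \<phi> :: "'a::real_normed_vector \<Rightarrow> 'b::real_normed_vector"
  assumes add: "\<And>x y. \<phi> (x + y) = \<phi> x + \<phi> y" and bound: "\<And>x. norm (\<phi> x) \<le> K * norm x"
  shows "continuous_on S \<phi>"
proof -
  have diff: "\<phi> x - \<phi> y = \<phi> (x - y)" for x y
    using add[of "x - y" y] by simp
  have "(\<bar>K\<bar>)-lipschitz_on S \<phi>"
  proof (rule lipschitz_onI)
    fix x y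
    have "norm (\<phi> (x - y)) \<le> \<bar>K\<bar> * norm (x - y)"
      using bound[of "x - y"] by (meson abs_ge_self mult_right_mono norm_ge_zero order_trans)
    then show "dist (\<phi> x) (\<phi> y) \<le> \<bar>K\<bar> * dist x y"
      by (simp add: dist_norm diff)
  qed simp
  then show ?thesis by (rule lipschitz_on_continuous_on)
qed

section \<open>Isomorphisms of quotient spaces\<close>

text \<open>The map \<open>\<theta>\<close> from V' to V descends to the quotients: \<open>W\<close>
  makes the induced map well defined and injective, and \<open>surj\<close> makes it
  surjective.\<close>

lemma quotients_isomorphicI:
  fixes V W :: "'v::complex_vector set" and V' W' :: "'w::complex_vector set"
  assumes sub: "csubspace V" "csubspace W" "W \<subseteq> V" "csubspace V'" "csubspace W'" "W' \<subseteq> V'"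
    and add: "\<And>x y. x \<in> V' \<Longrightarrow> y \<in> V' \<Longrightarrow> \<theta> (x + y) = \<theta> x + \<theta> y"
    and scale: "\<And>c x. x \<in> V' \<Longrightarrow> \<theta> (c *\<^sub>C x) = c *\<^sub>C \<theta> x"
    and V: "\<And>x. x \<in> V' \<Longrightarrow> \<theta> x \<in> V" and W: "\<And>x. x \<in> V' \<Longrightarrow> \<theta> x \<in> W \<longleftrightarrow> x \<in> W'"
    and surj: "\<And>v. v \<in> V \<Longrightarrow> \<exists>x \<in> V'. v - \<theta> x \<in> W"
  shows "quotients_isomorphic V W V' W'"
proof -
  have diff: "\<theta> (x - y) = \<theta> x - \<theta> y" if "x \<in> V'" "y \<in> V'" for x y
    using add[of "x - y" y] that complex_vector.subspace_diff[OF sub(4) that]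
    by (simp add: algebra_simps)
  have coset: "u \<in> v +o Z \<longleftrightarrow> u - v \<in> Z" for u v :: "'z::ab_group_add" and Z
    by (auto simp: elt_set_plus_def algebra_simps intro: bexI[of _ "u - v"])
  have coset_eq: "u +o Z = v +o Z \<longleftrightarrow> u - v \<in> Z" if Z: "csubspace Z"
    for u v :: "'z::complex_vector" and Z
  proof
    assume "u +o Z = v +o Z"
    then have "u \<in> v +o Z"
      using coset[of u u Z] complex_vector.subspace_0[OF Z] by simp
    then show "u - v \<in> Z" by (simp add: coset)
  next
    assume uv: "u - v \<in> Z"
    have "x - u \<in> Z \<longleftrightarrow> x - v \<in> Z" for x
      using complex_vector.subspace_add[OF Z _ uv, of "x - u"]
        complex_vector.subspace_diff[OF Z _ uv, of "x - v"] by auto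
    then show "u +o Z = v +o Z" by (auto simp: coset)
  qed
  have coset_add: "(u +o Z) + (v +o Z) = (u + v) +o Z" if Z: "csubspace Z"
    for u v :: "'z::complex_vector" and Z
  proof -
    have "Z + Z = Z"
      using complex_vector.subspace_add[OF Z] complex_vector.subspace_0[OF Z]
      by (force simp: set_plus_def)
    then show ?thesis
      by (simp add: set_plus_rearrange)
  qed
  have coset_scale: "quotient_scale Z c (v +o Z) = (c *\<^sub>C v) +o Z" if Z: "csubspace Z"
    for v :: "'z::complex_vector" and Z c
  proof (intro set_eqI iffI)
    fix u assume "u \<in> quotient_scale Z c (v +o Z)"
    then obtain z z' where "z \<in> Z" "z' \<in> Z" "u = c *\<^sub>C (v + z) + z'"
      by (auto simp: quotient_scale_def set_plus_def elt_set_plus_def)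
    then show "u \<in> (c *\<^sub>C v) +o Z"
      using complex_vector.subspace_add[OF Z complex_vector.subspace_scale[OF Z]]
      by (simp add: coset scaleC_add_right)
  next
    fix u assume "u \<in> (c *\<^sub>C v) +o Z"
    then have "u - c *\<^sub>C v \<in> Z"
      by (simp add: coset)
    moreover have "v \<in> v +o Z"
      using complex_vector.subspace_0[OF Z] by (simp add: coset)
    ultimately show "u \<in> quotient_scale Z c (v +o Z)"
      unfolding quotient_scale_def
      using set_plus_intro[OF imageI[OF \<open>v \<in> v +o Z\<close>, of "scaleC c"] \<open>u - c *\<^sub>C v \<in> Z\<close>] by simp
  qed
  \<comment> \<open>The inverse of the induced map, written as a preimage of cosets so that no
    representative has to be chosen.\<close>
  define \<Phi> where "\<Phi> C = {x \<in> V'. \<theta> x \<in> C}" for C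
  have \<Phi>: "\<Phi> (v +o W) = x +o W'" if v: "v \<in> V" and x: "x \<in> V'" and vx: "v - \<theta> x \<in> W" for v x
  proof (intro set_eqI)
    fix y
    have y: "y \<in> V' \<longleftrightarrow> y - x \<in> V'"
      using complex_vector.subspace_add[OF sub(4) _ x, of "y - x"]
        complex_vector.subspace_diff[OF sub(4) _ x, of y] by auto
    moreover have "\<theta> y - v \<in> W \<longleftrightarrow> \<theta> (y - x) \<in> W" if "y \<in> V'"
      using x that complex_vector.subspace_add[OF sub(2) _ vx, of "\<theta> y - v"]
        complex_vector.subspace_diff[OF sub(2) _ vx, of "\<theta> (y - x)"] by (auto simp: diff)
    ultimately show "y \<in> \<Phi> (v +o W) \<longleftrightarrow> y \<in> x +o W'"
      using W sub(6) by (auto simp: \<Phi>_def coset)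
  qed
  have "inj_on \<Phi> (quotient_space V W)"
  proof (rule inj_onI)
    fix C D assume "C \<in> quotient_space V W" "D \<in> quotient_space V W" and eq: "\<Phi> C = \<Phi> D"
    then obtain u v where u: "u \<in> V" "C = u +o W" and v: "v \<in> V" "D = v +o W"
      unfolding quotient_space_def by blast
    obtain x y where x: "x \<in> V'" "u - \<theta> x \<in> W" and y: "y \<in> V'" "v - \<theta> y \<in> W"
      using surj u v by meson
    have "x - y \<in> W'"
      using eq by (simp add: u v \<Phi>[OF u(1) x] \<Phi>[OF v(1) y] coset_eq[OF sub(5)])
    then have "\<theta> (x - y) \<in> W"
      using W sub(6) by blast
    \<comment> \<open>By additivity of \<open>\<theta>\<close> this sum is u - v.\<close>
    then have "(u - \<theta> x) - (v - \<theta> y) + \<theta> (x - y) \<in> W"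
      by (intro complex_vector.subspace_add[OF sub(2)] complex_vector.subspace_diff[OF sub(2)] x y)
    then show "C = D"
      by (simp add: u v coset_eq[OF sub(2)] diff x y)
  qed
  moreover have "\<Phi> ` quotient_space V W = quotient_space V' W'"
  proof (intro equalityI subsetI)
    fix C assume "C \<in> \<Phi> ` quotient_space V W"
    then obtain v where "v \<in> V" "C = \<Phi> (v +o W)" by (auto simp: quotient_space_def)
    then show "C \<in> quotient_space V' W'"
      using surj \<Phi> by (fastforce simp: quotient_space_def)
  next
    fix C assume "C \<in> quotient_space V' W'"
    then obtain x where x: "x \<in> V'" "C = x +o W'" by (auto simp: quotient_space_def)
    then have "C = \<Phi> (\<theta> x +o W)"
      using \<Phi>[OF V x(1)] complex_vector.subspace_0[OF sub(2)] by simp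
    then show "C \<in> \<Phi> ` quotient_space V W"
      using V x unfolding quotient_space_def by blast
  qed
  moreover have "\<Phi> (C + D) = \<Phi> C + \<Phi> D"
    if "C \<in> quotient_space V W" "D \<in> quotient_space V W" for C D
  proof -
    obtain u v where u: "u \<in> V" "C = u +o W" and v: "v \<in> V" "D = v +o W"
      using \<open>C \<in> quotient_space V W\<close> \<open>D \<in> quotient_space V W\<close> unfolding quotient_space_def by blast
    obtain x y where x: "x \<in> V'" "u - \<theta> x \<in> W" and y: "y \<in> V'" "v - \<theta> y \<in> W"
      using surj u v by meson
    have "(u + v) - \<theta> (x + y) \<in> W"
      using complex_vector.subspace_add[OF sub(2) x(2) y(2)] by (simp add: add x y algebra_simps)
    then have "\<Phi> ((u + v) +o W) = (x + y) +o W'"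
      by (intro \<Phi> complex_vector.subspace_add[OF sub(1)] complex_vector.subspace_add[OF sub(4)] u v x y)
    then show ?thesis
      by (simp add: u v \<Phi>[OF u(1) x] \<Phi>[OF v(1) y] coset_add sub)
  qed
  moreover have "\<Phi> (quotient_scale W c C) = quotient_scale W' c (\<Phi> C)"
    if "C \<in> quotient_space V W" for c C
  proof -
    obtain v where v: "v \<in> V" "C = v +o W"
      using \<open>C \<in> quotient_space V W\<close> unfolding quotient_space_def by blast
    obtain x where x: "x \<in> V'" "v - \<theta> x \<in> W"
      using surj v by meson
    have "c *\<^sub>C v - \<theta> (c *\<^sub>C x) \<in> W"
      using complex_vector.subspace_scale[OF sub(2) x(2)]
      by (simp add: scale x complex_vector.scale_right_diff_distrib)
    then have "\<Phi> ((c *\<^sub>C v) +o W) = (c *\<^sub>C x) +o W'"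
      by (intro \<Phi> complex_vector.subspace_scale[OF sub(1)] complex_vector.subspace_scale[OF sub(4)] v x)
    then show ?thesis
      by (simp add: v \<Phi>[OF v(1) x] coset_scale sub)
  qed
  ultimately show ?thesis
    using sub unfolding quotients_isomorphic_def bij_betw_def
    by (intro conjI exI[of _ \<Phi>] ballI allI) simp_all
qed

text \<open>As n \<ge> 1, level 2 n is a dual space and the bidual of \<open>S a\<close> is a
  transpose, hence weak-star continuous. It therefore maps a weak-star cluster point of
  \<open>\<delta> e\<close> to \<open>\<eta> a\<close>, with one y serving all a.\<close>

lemma weak_star_module_element:
  fixes E :: "('m::complex_normed_vector, 'u::complex_normed_vector) dual_tower"
  assumes n: "1 \<le> n" and E: "iterated_dual (2 * n) {0} E" and S: "\<And>a. bounded_clinear (S a)"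
    and F: "F \<noteq> bot" and \<delta>: "\<And>e. \<delta> e \<in> lev E (2 * n)" and K: "\<forall>\<^sub>F e in F. norm (\<delta> e) \<le> K"
    and \<eta>: "\<And>a. \<eta> a \<in> lev E (2 * n)"
    and lim: "\<And>a. ((\<lambda>e. bidual E E (S a) n (\<delta> e)) \<longlongrightarrow> \<eta> a) F"
  shows "\<exists>y \<in> lev E (2 * n). \<forall>a. bidual E E (S a) n y = \<eta> a"
proof -
  obtain m where m: "n = Suc m" using n by (cases n) auto
  define j where "j = 2 * m + 1"
  have j: "2 * n = Suc j" by (simp add: m j_def)
  have dp: "dual_pairing (lev E j) (lev E (Suc j)) (pr E j)"
    using iterated_dual_pairing[OF E, of j] j by simp
  have dp': "dual_pairing (lev E (2 * m)) (lev E (Suc (2 * m))) (pr E (2 * m))"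
    using iterated_dual_pairing[OF E, of "2 * m"] m by simp
  obtain y where y: "y \<in> lev E (Suc j)"
    and lim_y: "\<And>x l. x \<in> lev E j \<Longrightarrow> ((\<lambda>e. pr E j (\<delta> e) x) \<longlongrightarrow> l) F \<Longrightarrow> pr E j y x = l"
    by (rule weak_star_cluster_point[OF dp F, of \<delta> K]) (use \<delta> K j in auto)
  have "bidual E E (S a) n y = \<eta> a" for a
  proof -
    \<comment> \<open>\<open>R\<close> acts on level j = 2 n - 1, the predual of level 2 n, and the
      bidual of \<open>S a\<close> is its transpose.\<close>
    define R where "R = dual_map E E (2 * m) (bidual E E (S a) m)"
    obtain L where "bounded_clinear_on UNIV UNIV L (S a)"
      using S unfolding bounded_clinear_def by blast
    then have "bounded_clinear_on (lev E (2 * m)) (lev E (2 * m)) L (bidual E E (S a) m)"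
      using m by (intro bidual_bounded_on[OF E E]) auto
    then have R: "bounded_clinear_on (lev E j) (lev E j) L R"
      using dual_map_bounded[OF dp' dp'] by (simp add: R_def j_def)
    have bid: "bidual E E (S a) n = dual_map E E j R"
      by (simp add: m R_def j_def)
    show ?thesis
    proof (rule pairing_eqI[OF dp])
      show "bidual E E (S a) n y \<in> lev E (Suc j)" "\<eta> a \<in> lev E (Suc j)"
        using bidual_mem[OF E E S] y \<eta>[of a] by (simp_all add: j)
      fix x assume x: "x \<in> lev E j"
      \<comment> \<open>Norm convergence in the dual implies convergence of the pairing with each
        x.\<close>
      have "((\<lambda>e. pr E j (bidual E E (S a) n (\<delta> e)) x) \<longlongrightarrow> pr E j (\<eta> a) x) F"
      proof (rule LIM_zero_cancel, rule Lim_null_comparison)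
        have mem: "bidual E E (S a) n (\<delta> e) \<in> lev E (Suc j)" "\<eta> a \<in> lev E (Suc j)" for e
          using bidual_mem[OF E E S \<delta>, of a e] \<eta>[of a] by (simp_all add: j)
        note sub = pairing_subspaces(2)[OF dp]
        have "pr E j (bidual E E (S a) n (\<delta> e)) x - pr E j (\<eta> a) x =
            pr E j (bidual E E (S a) n (\<delta> e) - \<eta> a) x" for e
          using pairing_add_left[OF dp complex_vector.subspace_diff[OF sub mem(1)[of e] mem(2)] mem(2) x] by simp
        then have "cmod (pr E j (bidual E E (S a) n (\<delta> e)) x - pr E j (\<eta> a) x) \<le>
            norm (bidual E E (S a) n (\<delta> e) - \<eta> a) * norm x" for e
          using pairing_bound[OF dp complex_vector.subspace_diff[OF sub mem(1)[of e] mem(2)] x] by simp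
        then show "\<forall>\<^sub>F e in F. cmod (pr E j (bidual E E (S a) n (\<delta> e)) x - pr E j (\<eta> a) x) \<le>
            norm (bidual E E (S a) n (\<delta> e) - \<eta> a) * norm x"
          by simp
        show "((\<lambda>e. norm (bidual E E (S a) n (\<delta> e) - \<eta> a) * norm x) \<longlongrightarrow> 0) F"
          by (rule tendsto_mult_left_zero, rule tendsto_norm_zero, rule LIM_zero, rule lim)
      qed
      moreover have "pr E j (bidual E E (S a) n (\<delta> e)) x = pr E j (\<delta> e) (R x)" for e
        using dual_map_char(2)[OF dp dp R _ x] \<delta>[of e] by (simp add: bid j)
      ultimately have "pr E j y (R x) = pr E j (\<eta> a) x"
        using R x by (intro lim_y) (auto simp: bounded_clinear_on_def)
      then show "pr E j (bidual E E (S a) n y) x = pr E j (\<eta> a) x"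
        using dual_map_char(2)[OF dp dp R y x] by (simp add: bid)
    qed
  qed
  then show ?thesis using y j by auto
qed

section \<open>Derivations into even duals and boundedness of actions\<close>

text \<open>At even order the exchange of sides has cancelled, and as the two scalar actions agree,
  their two conditions merge into one.\<close>

lemma dual_derivations_even:
  assumes "\<And>s x. r x s = l s x"
  shows "D \<in> dual_derivations (2 * k) mul l r E \<longleftrightarrow>
     (\<forall>a. D a \<in> lev E (2 * k)) \<and> (\<forall>a b. D (a + b) = D a + D b) \<and>
     (\<forall>s a. D (l s a) = bidual E E (l s) k (D a)) \<and> (\<exists>K. \<forall>a. norm (D a) \<le> K * norm a) \<and>
     (\<forall>a b. D (mul a b) =
       bidual E E (\<lambda>x. mul x b) k (D a) + bidual E E (mul a) k (D b))"
  by (auto simp: dual_derivations_def module_derivations_def dual_left_def dual_right_def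
      iterated_dual_map_even assms)

lemma inner_on_even:
  "inner_on X (dual_left E (2 * k) mul mul) (dual_right E (2 * k) mul mul) D \<longleftrightarrow>
     (\<exists>x \<in> X. \<forall>a. D a = bidual E E (mul a) k x - bidual E E (\<lambda>x. mul x a) k x)"
  by (simp add: inner_on_def dual_left_def dual_right_def iterated_dual_map_even)

lemma bounded_cbilinear_bounds:
  assumes "bounded_cbilinear f"
  shows "\<exists>C. (\<forall>x. bounded_clinear_on UNIV UNIV (C * norm x) (f x)) \<and>
    (\<forall>y. bounded_clinear_on UNIV UNIV (C * norm y) (\<lambda>x. f x y))"
proof -
  interpret bounded_bilinear f
    using assms by (simp add: bounded_cbilinear_def)
  obtain C where C: "0 \<le> C" "\<And>x y. norm (f x y) \<le> norm x * norm y * C"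
    using nonneg_bounded by blast
  then have "norm (f x y) \<le> C * norm x * norm y" "norm (f x y) \<le> C * norm y * norm x" for x y
    using C(2)[of x y] by (simp_all add: mult_ac)
  then show ?thesis
    using assms C(1) by (intro exI[of _ C])
      (auto simp: bounded_clinear_on_def bounded_cbilinear_def add_left add_right)
qed

lemma bounded_cbilinear_bounded_clinear:
  assumes "bounded_cbilinear f"
  shows "bounded_clinear (f x)" and "bounded_clinear (\<lambda>x. f x y)"
  using bounded_cbilinear_bounds[OF assms] unfolding bounded_clinear_def by blast+

lemma bounded_cbilinear_mult:
  "bounded_cbilinear ((*) :: 'a \<Rightarrow> 'a \<Rightarrow> 'a::complex_banach_algebra)"
  by (simp add: bounded_cbilinear_def bounded_bilinear_mult mult_scaleC_left mult_scaleC_right)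

lemma bounded_clinear_Tri:
  assumes "bounded_clinear f" "bounded_clinear g" "bounded_clinear h"
  shows "bounded_clinear (\<lambda>x. Tri (f x) (g x) (h x))"
proof -
  obtain K L M where K: "bounded_clinear_on UNIV UNIV K f" and L: "bounded_clinear_on UNIV UNIV L g"
    and M: "bounded_clinear_on UNIV UNIV M h"
    using assms unfolding bounded_clinear_def by blast
  have "norm (Tri (f x) (g x) (h x)) \<le> (K + L + M) * norm x" for x
  proof -
    have "norm (f x) \<le> K * norm x" "norm (g x) \<le> L * norm x" "norm (h x) \<le> M * norm x"
      using K L M by (auto simp: bounded_clinear_on_def)
    then show ?thesis by (simp add: norm_tri_def distrib_right)
  qed
  then have "bounded_clinear_on UNIV UNIV (K + L + M) (\<lambda>x. Tri (f x) (g x) (h x))"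
    using K L M by (auto simp: bounded_clinear_on_def plus_tri_def scaleC_tri_def)
  then show ?thesis unfolding bounded_clinear_def by blast
qed

lemma bounded_clinear_tri_entries:
  "bounded_clinear ul" "bounded_clinear ur" "bounded_clinear lr"
  unfolding bounded_clinear_def
  by (rule exI[of _ 1], simp add: bounded_clinear_on_def plus_tri_def scaleC_tri_def norm_tri_def)+

lemma nondegenerateD:
  assumes "nondegenerate X l r" and "x \<in> X"
  shows "(\<And>a. l a x = 0) \<Longrightarrow> x = 0" and "(\<And>b. r x b = 0) \<Longrightarrow> x = 0"
  using assms unfolding nondegenerate_def by blast+

lemma weakly_module_amenableD:
  assumes "weakly_module_amenable (2 * k) l r E"
  shows "\<forall>D \<in> dual_derivations (2 * k) (*) l r E. \<exists>x \<in> lev E (2 * k).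
    \<forall>a. D a = bidual E E ((*) a) k x - bidual E E (\<lambda>x. x * a) k x"
  using assms by (simp add: weakly_module_amenable_def inner_on_even)

text \<open>Prepares the nets for \<open>weak_star_module_element\<close>: a bounded additive map is
  continuous and so carries the approximate identity to a bounded net with the required
  limits.\<close>

lemma bounded_approximate_identity_limits:
  fixes F :: "'c::complex_banach_algebra filter" and \<delta> :: "'c \<Rightarrow> 'z::real_normed_vector"
  assumes F: "bounded_approximate_identity F"
    and add: "\<And>x y. \<delta> (x + y) = \<delta> x + \<delta> y" and bound: "\<exists>K. \<forall>x. norm (\<delta> x) \<le> K * norm x"
  shows "F \<noteq> bot" and "\<exists>K. \<forall>\<^sub>F e in F. norm (\<delta> e) \<le> K"
    and "((\<lambda>e. \<delta> (e * a)) \<longlongrightarrow> \<delta> a) F" and "((\<lambda>e. \<delta> (a * e)) \<longlongrightarrow> \<delta> a) F"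
proof -
  obtain K where K: "\<And>x. norm (\<delta> x) \<le> K * norm x" using bound by blast
  show "F \<noteq> bot" using F by (simp add: bounded_approximate_identity_def)
  obtain L where "\<forall>\<^sub>F e in F. norm e \<le> L"
    using F unfolding bounded_approximate_identity_def by blast
  then have "\<forall>\<^sub>F e in F. norm (\<delta> e) \<le> \<bar>K\<bar> * L"
  proof eventually_elim
    case (elim e)
    have "norm (\<delta> e) \<le> \<bar>K\<bar> * norm e"
      using K[of e] by (meson abs_ge_self mult_right_mono norm_ge_zero order_trans)
    also have "\<dots> \<le> \<bar>K\<bar> * L" using elim by (simp add: mult_left_mono)
    finally show ?case .
  qed
  then show "\<exists>K. \<forall>\<^sub>F e in F. norm (\<delta> e) \<le> K" by blast
  have "isCont \<delta> a"
    using bounded_additive_continuous[OF add K, of UNIV] by (simp add: continuous_on_eq_continuous_at)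
  then show "((\<lambda>e. \<delta> (e * a)) \<longlongrightarrow> \<delta> a) F" "((\<lambda>e. \<delta> (a * e)) \<longlongrightarrow> \<delta> a) F"
    using F isCont_tendsto_compose unfolding bounded_approximate_identity_def by blast+
qed

section \<open>Biduals of triangular algebras\<close>

text \<open>Collects the module structure and the towers. Approximate identity, nondegeneracy and
  amenability enter later, in the context of a single derivation.\<close>

locale triangular_duals =
  fixes n :: nat
    and lA :: "'k::complex_banach_algebra \<Rightarrow> 'a::complex_banach_algebra \<Rightarrow> 'a"
    and rA :: "'a \<Rightarrow> 'k \<Rightarrow> 'a"
    and lB :: "'k \<Rightarrow> 'b::complex_banach_algebra \<Rightarrow> 'b"
    and rB :: "'b \<Rightarrow> 'k \<Rightarrow> 'b"
    and lM :: "'k \<Rightarrow> 'm::complex_banach \<Rightarrow> 'm"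
    and rM :: "'m \<Rightarrow> 'k \<Rightarrow> 'm"
    and actA :: "'a \<Rightarrow> 'm \<Rightarrow> 'm"
    and actB :: "'m \<Rightarrow> 'b \<Rightarrow> 'm"
    and EA :: "('a, 'ua::complex_normed_vector) dual_tower"
    and EB :: "('b, 'ub::complex_normed_vector) dual_tower"
    and EM :: "('m, 'um::complex_normed_vector) dual_tower"
    and ET :: "(('a, 'm, 'b) tri, 'ut::complex_normed_vector) dual_tower"
  assumes n: "n \<ge> 1"
    and algA: "banach_algebra_module lA rA" and comA: "commutative_actions lA rA"
    and algB: "banach_algebra_module lB rB" and comB: "commutative_actions lB rB"
    and modM: "banach_AB_module lA rB lM rM actA actB" and comM: "commutative_actions lM rM"
    and EA [simp]: "iterated_dual (2 * n) {0} EA"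
    and EB [simp]: "iterated_dual (2 * n) {0} EB"
    and EM [simp]: "iterated_dual (2 * n) {0} EM"
    and ET [simp]: "iterated_dual (2 * n) {0} ET"
begin

abbreviation "XA \<equiv> lev EA (2 * n)"
abbreviation "XB \<equiv> lev EB (2 * n)"
abbreviation "XM \<equiv> lev EM (2 * n)"
abbreviation "XT \<equiv> lev ET (2 * n)"

text \<open>The acting element comes first even for right actions, so that every action is the
  bidual of a unary map.\<close>

abbreviation "LA a \<equiv> bidual EA EA ((*) a) n"
abbreviation "RA a \<equiv> bidual EA EA (\<lambda>x. x * a) n"
abbreviation "LB b \<equiv> bidual EB EB ((*) b) n"
abbreviation "RB b \<equiv> bidual EB EB (\<lambda>x. x * b) n"
abbreviation "LM a \<equiv> bidual EM EM (actA a) n"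
abbreviation "RM b \<equiv> bidual EM EM (\<lambda>m. actB m b) n"
abbreviation "extA m \<equiv> bidual EA EM (\<lambda>a. actA a m) n"
abbreviation "extB m \<equiv> bidual EB EM (actB m) n"
abbreviation "mul \<equiv> tri_mult actA actB"
abbreviation "kmul \<alpha> \<equiv> diag_left lA lM lB (Diag \<alpha>)"
abbreviation "TL t \<equiv> bidual ET ET (mul t) n"
abbreviation "TR t \<equiv> bidual ET ET (\<lambda>s. mul s t) n"
abbreviation "KA \<alpha> \<equiv> bidual EA EA (lA \<alpha>) n"
abbreviation "KB \<alpha> \<equiv> bidual EB EB (lB \<alpha>) n"
abbreviation "KM \<alpha> \<equiv> bidual EM EM (lM \<alpha>) n"
abbreviation "KT \<alpha> \<equiv> bidual ET ET (kmul \<alpha>) n"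
text \<open>\<open>ET\<close> is an arbitrary realisation and not a product of the other towers;
  biduals of the coordinate projections and injections supply the splitting.\<close>

abbreviation "qA \<equiv> bidual ET EA ul n"
abbreviation "qM \<equiv> bidual ET EM ur n"
abbreviation "qB \<equiv> bidual ET EB lr n"
abbreviation "jA \<equiv> bidual EA ET (\<lambda>a. Tri a 0 0) n"
abbreviation "jM \<equiv> bidual EM ET (\<lambda>m. Tri 0 m 0) n"
abbreviation "jB \<equiv> bidual EB ET (\<lambda>b. Tri 0 0 b) n"

lemma bilinear: "bounded_cbilinear actA" "bounded_cbilinear actB"
  "bounded_cbilinear lA" "bounded_cbilinear lB" "bounded_cbilinear lM"
  using algA algB modM
  by (simp_all add: banach_algebra_module_def banach_AB_module_def banach_bimodule_def
      left_banach_module_def right_banach_module_def)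

lemma right_actions: "rA a \<alpha> = lA \<alpha> a" "rB b \<alpha> = lB \<alpha> b" "rM m \<alpha> = lM \<alpha> m"
  using comA comB comM by (simp_all add: commutative_actions_def)

lemma act_mult: "actA a (actA a' m) = actA (a * a') m" "actB (actB m b) b' = actB m (b * b')"
  "actB (actA a m) b = actA a (actB m b)"
  using modM
  by (simp_all add: banach_AB_module_def banach_bimodule_def left_banach_module_def
      right_banach_module_def)

lemma scalar_mult:
  "lA \<alpha> a * a' = lA \<alpha> (a * a')" "a * lA \<alpha> a' = lA \<alpha> (a * a')"
  "lB \<alpha> b * b' = lB \<alpha> (b * b')" "b * lB \<alpha> b' = lB \<alpha> (b * b')"
  "actA (lA \<alpha> a) m = lM \<alpha> (actA a m)" "actA a (lM \<alpha> m) = lM \<alpha> (actA a m)"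
  "actB (lM \<alpha> m) b = lM \<alpha> (actB m b)" "actB m (lB \<alpha> b) = lM \<alpha> (actB m b)"
  using algA algB modM
  unfolding banach_algebra_module_def banach_AB_module_def right_actions by metis+

lemma bilinear_simps [simp]:
  "actA 0 m = 0" "actA a 0 = 0" "actB 0 b = 0" "actB m 0 = 0"
  "lA \<alpha> 0 = 0" "lB \<alpha> 0 = 0" "lM \<alpha> 0 = 0"
  "actA a (m + m') = actA a m + actA a m'" "actB (m + m') b = actB m b + actB m' b"
  "actA (a + a') m = actA a m + actA a' m" "actB m (b + b') = actB m b + actB m b'"
  "lM \<alpha> (m + m') = lM \<alpha> m + lM \<alpha> m'"
  using bilinear unfolding bounded_cbilinear_def
  by (simp_all add: bounded_bilinear.zero_left bounded_bilinear.zero_right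
      bounded_bilinear.add_left bounded_bilinear.add_right)

text \<open>Stated for an arbitrary inner map, so that simplification can follow the structure of
  any composite of the actions.\<close>

lemma bounded_clinear_maps:
  "bounded_clinear S \<Longrightarrow> bounded_clinear (\<lambda>x. actA a (S x))"
  "bounded_clinear U \<Longrightarrow> bounded_clinear (\<lambda>x. actA (U x) m)"
  "bounded_clinear S \<Longrightarrow> bounded_clinear (\<lambda>x. actB (S x) b)"
  "bounded_clinear V \<Longrightarrow> bounded_clinear (\<lambda>x. actB m (V x))"
  "bounded_clinear U \<Longrightarrow> bounded_clinear (\<lambda>x. lA \<alpha> (U x))"
  "bounded_clinear V \<Longrightarrow> bounded_clinear (\<lambda>x. lB \<alpha> (V x))"
  "bounded_clinear S \<Longrightarrow> bounded_clinear (\<lambda>x. lM \<alpha> (S x))"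
  by (rule bounded_clinear_comp, assumption,
      rule bounded_clinear_id bounded_cbilinear_bounded_clinear[OF bilinear(1)]
        bounded_cbilinear_bounded_clinear[OF bilinear(2)]
        bounded_cbilinear_bounded_clinear[OF bilinear(3)]
        bounded_cbilinear_bounded_clinear[OF bilinear(4)]
        bounded_cbilinear_bounded_clinear[OF bilinear(5)])+

lemma bounded_clinear_mult:
  fixes U :: "'z::complex_normed_vector \<Rightarrow> 'c::complex_banach_algebra"
  shows "bounded_clinear U \<Longrightarrow> bounded_clinear (\<lambda>x. a * U x)"
    and "bounded_clinear U \<Longrightarrow> bounded_clinear (\<lambda>x. U x * a)"
  by (rule bounded_clinear_comp, assumption,
      rule bounded_cbilinear_bounded_clinear[OF bounded_cbilinear_mult])+

lemma bounded_clinear_entries: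
  fixes S :: "'z::complex_normed_vector \<Rightarrow> ('x::complex_normed_vector, 'y::complex_normed_vector, 'w::complex_normed_vector) tri"
  assumes "bounded_clinear S"
  shows "bounded_clinear (\<lambda>x. ul (S x))" "bounded_clinear (\<lambda>x. ur (S x))"
    "bounded_clinear (\<lambda>x. lr (S x))"
  by (rule bounded_clinear_comp[OF assms], rule bounded_clinear_tri_entries)+

lemmas bounded_clinear_intros [simp] = bounded_clinear_maps bounded_clinear_mult bounded_clinear_entries
  bounded_clinear_Tri bounded_clinear_add bounded_clinear_id bounded_clinear_zero

lemma bounded_clinear_actions [simp]:
  "bounded_clinear (actA a)" "bounded_clinear (actB m)"
  "bounded_clinear (lA \<alpha>)" "bounded_clinear (lB \<alpha>)" "bounded_clinear (lM \<alpha>)"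
  "bounded_clinear ((*) (c::'c::complex_banach_algebra))"
  "bounded_clinear (ul :: ('a, 'm, 'b) tri \<Rightarrow> 'a)"
  "bounded_clinear (ur :: ('a, 'm, 'b) tri \<Rightarrow> 'm)"
  "bounded_clinear (lr :: ('a, 'm, 'b) tri \<Rightarrow> 'b)"
  by (rule bounded_clinear_intros(1,4-8,10-12)[OF bounded_clinear_id])+

lemma bounded_clinear_triangular [simp]:
  "bounded_clinear (mul t)" "bounded_clinear (\<lambda>s. mul s t)" "bounded_clinear (kmul \<alpha>)"
proof -
  have "bounded_clinear (\<lambda>s. mul t s)" "bounded_clinear (\<lambda>s. mul s t)"
    "bounded_clinear (\<lambda>s. kmul \<alpha> s)"
    unfolding tri_mult_def diag_left_def by simp_all
  then show "bounded_clinear (mul t)" "bounded_clinear (\<lambda>s. mul s t)" "bounded_clinear (kmul \<alpha>)"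
    by simp_all
qed

lemmas top_bidual_comp = bidual_comp[where N = "2 * n" and k = n, OF _ _ _ _ _ order_refl]
lemmas top_bidual_add = bidual_add[where N = "2 * n" and k = n, OF _ _ _ _ order_refl]
lemmas top_bidual_id = bidual_id[where N = "2 * n" and k = n, OF _ order_refl]

lemma level_subspaces: "csubspace XA" "csubspace XB" "csubspace XM" "csubspace XT"
  using n by (simp_all add: iterated_dual_subspace[where N = "2 * n" and J = "{0}"])

lemma level_closed [simp]:
  "x \<in> XA \<Longrightarrow> x' \<in> XA \<Longrightarrow> x + x' \<in> XA" "z \<in> XB \<Longrightarrow> z' \<in> XB \<Longrightarrow> z + z' \<in> XB"
  "y \<in> XM \<Longrightarrow> y' \<in> XM \<Longrightarrow> y + y' \<in> XM" "\<xi> \<in> XT \<Longrightarrow> \<xi>' \<in> XT \<Longrightarrow> \<xi> + \<xi>' \<in> XT"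
  "x \<in> XA \<Longrightarrow> x' \<in> XA \<Longrightarrow> x - x' \<in> XA" "z \<in> XB \<Longrightarrow> z' \<in> XB \<Longrightarrow> z - z' \<in> XB"
  "y \<in> XM \<Longrightarrow> y' \<in> XM \<Longrightarrow> y - y' \<in> XM" "\<xi> \<in> XT \<Longrightarrow> \<xi>' \<in> XT \<Longrightarrow> \<xi> - \<xi>' \<in> XT"
  "x \<in> XA \<Longrightarrow> c *\<^sub>C x \<in> XA" "z \<in> XB \<Longrightarrow> c *\<^sub>C z \<in> XB"
  "y \<in> XM \<Longrightarrow> c *\<^sub>C y \<in> XM" "\<xi> \<in> XT \<Longrightarrow> c *\<^sub>C \<xi> \<in> XT"
  "x \<in> XA \<Longrightarrow> - x \<in> XA" "z \<in> XB \<Longrightarrow> - z \<in> XB" "y \<in> XM \<Longrightarrow> - y \<in> XM" "\<xi> \<in> XT \<Longrightarrow> - \<xi> \<in> XT"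
  "0 \<in> XA" "0 \<in> XB" "0 \<in> XM" "0 \<in> XT"
  by (rule complex_vector.subspace_add complex_vector.subspace_diff complex_vector.subspace_scale
      complex_vector.subspace_neg complex_vector.subspace_0, rule level_subspaces, assumption?, assumption?)+

lemmas top_bidual_linear [simp] = bidual_mem[where k = n] bidual_plus[where k = n] bidual_scaleC[where k = n]
  bidual_zero_map[where k = n]

context
  fixes E :: "('x::complex_normed_vector, 'u::complex_normed_vector) dual_tower"
    and F :: "('y::complex_normed_vector, 'v::complex_normed_vector) dual_tower"
    and S :: "'x \<Rightarrow> 'y"
  assumes E [simp]: "iterated_dual (2 * n) {0} E" and F [simp]: "iterated_dual (2 * n) {0} F"
    and S [simp]: "bounded_clinear S"
begin

lemma top_subspace: "csubspace (lev E (2 * n))"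
  using n by (simp add: iterated_dual_subspace[where N = "2 * n" and J = "{0}"])

lemma top_bidual_zero [simp]: "bidual E F S n 0 = 0"
  using top_bidual_linear(3)[of E F S 0 0] complex_vector.subspace_0[OF top_subspace] by simp

lemma top_bidual_minus [simp]: "\<xi> \<in> lev E (2 * n) \<Longrightarrow> bidual E F S n (- \<xi>) = - bidual E F S n \<xi>"
  using top_bidual_linear(3)[of E F S \<xi> "- 1"] unfolding scaleC_minus_one by simp

lemma top_bidual_diff [simp]:
  assumes "\<eta> \<in> lev E (2 * n)" and \<xi>: "\<xi> \<in> lev E (2 * n)"
  shows "bidual E F S n (\<eta> - \<xi>) = bidual E F S n \<eta> - bidual E F S n \<xi>"
  using assms complex_vector.subspace_neg[OF top_subspace \<xi>] top_bidual_linear(2)[of E F S \<eta> "- \<xi>"] by simp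

end

text \<open>Off-diagonal and missing entries act by zero. These four occur with the action partially
  applied, where the pointwise rules for zero cannot rewrite.\<close>

lemma null_actions [simp]:
  "y \<in> XM \<Longrightarrow> LM 0 y = 0" "x \<in> XA \<Longrightarrow> LA 0 x = 0" "z \<in> XB \<Longrightarrow> LB 0 z = 0" "z \<in> XB \<Longrightarrow> extB 0 z = 0"
proof -
  have "actA 0 = (\<lambda>m. 0)" "actB 0 = (\<lambda>b. 0)" "(*) (0::'a) = (\<lambda>a. 0)" "(*) (0::'b) = (\<lambda>b. 0)"
    by (simp_all add: fun_eq_iff)
  then show "y \<in> XM \<Longrightarrow> LM 0 y = 0" "x \<in> XA \<Longrightarrow> LA 0 x = 0" "z \<in> XB \<Longrightarrow> LB 0 z = 0"
    "z \<in> XB \<Longrightarrow> extB 0 z = 0"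
    by simp_all
qed

lemma triangular_entries [simp]:
  "ul (mul s t) = ul s * ul t" "ur (mul s t) = actA (ul s) (ur t) + actB (ur s) (lr t)"
  "lr (mul s t) = lr s * lr t"
  "ul (kmul \<alpha> t) = lA \<alpha> (ul t)" "ur (kmul \<alpha> t) = lM \<alpha> (ur t)" "lr (kmul \<alpha> t) = lB \<alpha> (lr t)"
  "ul (s + t) = ul s + ul t" "ur (s + t) = ur s + ur t" "lr (s + t) = lr s + lr t"
  by (simp_all add: tri_mult_def diag_left_def plus_tri_def)

text \<open>Composing an entry projection with matrix multiplication gives the entry formula for the
  product; functoriality and additivity lift it to the bidual. The corner thus receives one term
  from the opposite diagonal entry.\<close>

lemma projections_act:
  assumes [simp]: "\<xi> \<in> XT"
  shows "qA (TL t \<xi>) = LA (ul t) (qA \<xi>)"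
    and "qM (TL t \<xi>) = LM (ul t) (qM \<xi>) + extB (ur t) (qB \<xi>)"
    and "qB (TL t \<xi>) = LB (lr t) (qB \<xi>)"
    and "qA (TR t \<xi>) = RA (ul t) (qA \<xi>)"
    and "qM (TR t \<xi>) = extA (ur t) (qA \<xi>) + RM (lr t) (qM \<xi>)"
    and "qB (TR t \<xi>) = RB (lr t) (qB \<xi>)"
    and "qA (KT \<alpha> \<xi>) = KA \<alpha> (qA \<xi>)"
    and "qM (KT \<alpha> \<xi>) = KM \<alpha> (qM \<xi>)"
    and "qB (KT \<alpha> \<xi>) = KB \<alpha> (qB \<xi>)"
  by (simp_all add: top_bidual_comp top_bidual_add)

lemma projections_j [simp]:
  "x \<in> XA \<Longrightarrow> qA (jA x) = x" "x \<in> XA \<Longrightarrow> qM (jA x) = 0" "x \<in> XA \<Longrightarrow> qB (jA x) = 0"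
  "y \<in> XM \<Longrightarrow> qA (jM y) = 0" "y \<in> XM \<Longrightarrow> qM (jM y) = y" "y \<in> XM \<Longrightarrow> qB (jM y) = 0"
  "z \<in> XB \<Longrightarrow> qA (jB z) = 0" "z \<in> XB \<Longrightarrow> qM (jB z) = 0" "z \<in> XB \<Longrightarrow> qB (jB z) = z"
  by (simp_all add: top_bidual_comp top_bidual_id)

text \<open>The identity of the triangular algebra is the sum of its three coordinate idempotent
  maps, and the bidual preserves sums, composites and the identity.\<close>

lemma decomposition:
  assumes [simp]: "\<xi> \<in> XT"
  shows "\<xi> = jA (qA \<xi>) + jM (qM \<xi>) + jB (qB \<xi>)"
proof -
  have "jA (qA \<xi>) + jM (qM \<xi>) + jB (qB \<xi>) =
      bidual ET ET (\<lambda>t. Tri (ul t) 0 0 + Tri 0 (ur t) 0 + Tri 0 0 (lr t)) n \<xi>"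
    by (simp add: top_bidual_comp top_bidual_add)
  also have "(\<lambda>t. Tri (ul t) 0 0 + Tri 0 (ur t) 0 + Tri 0 0 (lr t)) = (\<lambda>t::('a, 'm, 'b) tri. t)"
    by (simp add: plus_tri_def)
  finally show ?thesis by (simp add: top_bidual_id)
qed

text \<open>All later identities in the dual of the triangular algebra are checked entrywise through
  this.\<close>

lemma triangular_dual_eqI: "\<xi> \<in> XT \<Longrightarrow> \<eta> \<in> XT \<Longrightarrow> qA \<xi> = qA \<eta> \<Longrightarrow> qM \<xi> = qM \<eta> \<Longrightarrow> qB \<xi> = qB \<eta> \<Longrightarrow> \<xi> = \<eta>"
  by (metis decomposition)

lemma mul_units:
  "mul (Tri a 0 0) (Tri a' 0 0) = Tri (a * a') 0 0" "mul (Tri 0 0 b) (Tri 0 0 b') = Tri 0 0 (b * b')"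
  "mul (Tri a 0 0) (Tri 0 0 b) = Tri 0 0 0" "mul (Tri a 0 0) (Tri 0 m 0) = Tri 0 (actA a m) 0"
  "mul (Tri 0 m 0) (Tri 0 0 b) = Tri 0 (actB m b) 0" "mul (Tri 0 m 0) (Tri a 0 0) = Tri 0 0 0"
  "mul (Tri 0 0 b) (Tri 0 m 0) = Tri 0 0 0"
  by (simp_all add: tri_mult_def)

lemma kmul_units:
  "kmul \<alpha> (Tri a 0 0) = Tri (lA \<alpha> a) 0 0" "kmul \<alpha> (Tri 0 m 0) = Tri 0 (lM \<alpha> m) 0"
  "kmul \<alpha> (Tri 0 0 b) = Tri 0 0 (lB \<alpha> b)"
  by (simp_all add: diag_left_def)

section \<open>Derivations of triangular algebras\<close>

abbreviation "derivations_T \<equiv> dual_derivations (2 * n) mul (diag_left lA lM lB) (diag_right rA rM rB) ET"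
abbreviation "inner_T \<equiv>
  inner_dual_derivations (2 * n) mul (diag_left lA lM lB) (diag_right rA rM rB) ET"
abbreviation "homs_M \<equiv> module_homs n EM lM rM actA actB"
abbreviation "ZR_M \<equiv> ZR n EA EB EM actA actB"

lemma derivations_T_iff:
  "D \<in> derivations_T \<longleftrightarrow>
     (\<forall>t. D t \<in> XT) \<and> (\<forall>s t. D (s + t) = D s + D t) \<and>
     (\<forall>\<alpha> t. D (kmul \<alpha> t) = KT \<alpha> (D t)) \<and> (\<exists>K. \<forall>t. norm (D t) \<le> K * norm t) \<and>
     (\<forall>s t. D (mul s t) = TR t (D s) + TL s (D t))"
proof -
  have diag: "diag_right rA rM rB t d = diag_left lA lM lB d t" for t d
    by (simp add: diag_right_def diag_left_def right_actions)
  have all_Diag: "(\<forall>d. P d) \<longleftrightarrow> (\<forall>\<alpha>. P (Diag \<alpha>))" for P :: "'k diag \<Rightarrow> bool"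
    by (metis diag.collapse)
  show ?thesis
    unfolding dual_derivations_even[where r = "diag_right rA rM rB" and l = "diag_left lA lM lB", OF diag]
    by (simp add: all_Diag)
qed

lemma inner_T_iff:
  "D \<in> inner_T \<longleftrightarrow> D \<in> derivations_T \<and> (\<exists>\<xi> \<in> XT. \<forall>t. D t = TL t \<xi> - TR t \<xi>)"
  by (simp add: inner_dual_derivations_def inner_on_even)

lemma homs_M_iff:
  "\<phi> \<in> homs_M \<longleftrightarrow>
     (\<forall>m. \<phi> m \<in> XM) \<and> continuous_on UNIV \<phi> \<and> (\<forall>m m'. \<phi> (m + m') = \<phi> m + \<phi> m') \<and>
     (\<forall>a m. \<phi> (actA a m) = LM a (\<phi> m)) \<and> (\<forall>m b. \<phi> (actB m b) = RM b (\<phi> m)) \<and>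
     (\<forall>\<alpha> m. \<phi> (lM \<alpha> m) = KM \<alpha> (\<phi> m))"
  by (auto simp: module_homs_def even_dual_left_def even_dual_right_def iterated_dual_map_even
      right_actions)

lemma ZR_M_iff:
  "\<phi> \<in> ZR_M \<longleftrightarrow> (\<exists>x \<in> XA. \<exists>z \<in> XB. (\<forall>a. RA a x = LA a x) \<and> (\<forall>b. RB b z = LB b z) \<and>
     \<phi> = (\<lambda>m. extA m x - extB m z))"
  by (auto simp: ZR_def center_dual_def dual_left_def dual_right_def iterated_dual_map_even
      ext_left_bidual ext_right_bidual)

lemma derivations_T_subspace: "csubspace derivations_T"
  unfolding complex_vector.subspace_def
proof (intro conjI ballI allI)
  show "0 \<in> derivations_T"
    by (auto simp: derivations_T_iff intro: exI[of _ 0])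
  fix D assume D: "D \<in> derivations_T"
  then obtain K where K: "\<And>t. norm (D t) \<le> K * norm t"
    by (auto simp: derivations_T_iff)
  have [simp]: "D t \<in> XT" for t
    using D by (simp add: derivations_T_iff)
  show "c *\<^sub>C D \<in> derivations_T" for c
  proof -
    have "norm (c *\<^sub>C D t) \<le> (cmod c * K) * norm t" for t
      using K[of t] by (simp add: norm_scaleC mult.assoc mult_left_mono)
    then have "\<exists>K. \<forall>t. norm (c *\<^sub>C D t) \<le> K * norm t" by blast
    then show ?thesis
      using D by (simp add: derivations_T_iff scaleC_fun_def scaleC_add_right)
  qed
  fix D' assume D': "D' \<in> derivations_T"
  then obtain K' where K': "\<And>t. norm (D' t) \<le> K' * norm t"
    by (auto simp: derivations_T_iff)
  have [simp]: "D' t \<in> XT" for t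
    using D' by (simp add: derivations_T_iff)
  have "norm (D t + D' t) \<le> (K + K') * norm t" for t
    using norm_triangle_mono[OF K K', of t t] by (simp add: distrib_right)
  then have "\<exists>K. \<forall>t. norm (D t + D' t) \<le> K * norm t" by blast
  then show "D + D' \<in> derivations_T"
    using D D' by (simp add: derivations_T_iff)
qed

lemma inner_T_subspace: "csubspace inner_T"
  unfolding complex_vector.subspace_def
proof (intro conjI ballI allI)
  note sub = derivations_T_subspace
  show "0 \<in> inner_T"
    using complex_vector.subspace_0[OF sub]
    by (auto simp: inner_T_iff intro!: bexI[of _ 0])
  fix D assume "D \<in> inner_T"
  then obtain \<xi> where D: "D \<in> derivations_T" and \<xi>: "\<xi> \<in> XT" "\<And>t. D t = TL t \<xi> - TR t \<xi>"
    unfolding inner_T_iff by blast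
  show "c *\<^sub>C D \<in> inner_T" for c
    unfolding inner_T_iff
  proof (intro conjI bexI[of _ "c *\<^sub>C \<xi>"] allI)
    show "c *\<^sub>C D \<in> derivations_T"
      by (rule complex_vector.subspace_scale[OF sub D])
  qed (simp_all add: \<xi> scaleC_fun_def complex_vector.scale_right_diff_distrib)
  fix D' assume "D' \<in> inner_T"
  then obtain \<xi>' where D': "D' \<in> derivations_T" and \<xi>': "\<xi>' \<in> XT" "\<And>t. D' t = TL t \<xi>' - TR t \<xi>'"
    unfolding inner_T_iff by blast
  show "D + D' \<in> inner_T"
    unfolding inner_T_iff
  proof (intro conjI bexI[of _ "\<xi> + \<xi>'"] allI)
    show "D + D' \<in> derivations_T"
      by (rule complex_vector.subspace_add[OF sub D D'])
  qed (simp_all add: \<xi> \<xi>')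
qed

lemma homs_M_subspace: "csubspace homs_M"
  unfolding complex_vector.subspace_def
proof (intro conjI ballI allI)
  show "0 \<in> homs_M"
    by (auto simp: homs_M_iff zero_fun_def)
  fix \<phi> assume \<phi>: "\<phi> \<in> homs_M"
  then have [simp]: "\<phi> m \<in> XM" for m
    by (simp add: homs_M_iff)
  have add: "\<And>m m'. \<phi> (m + m') = \<phi> m + \<phi> m'" and cont: "continuous_on UNIV \<phi>"
    using \<phi> by (simp_all add: homs_M_iff)
  \<comment> \<open>The bound serves only to obtain continuity of scalar multiples, via
    \<open>bounded_additive_continuous\<close>.\<close>
  then obtain K where K: "\<And>m. norm (\<phi> m) \<le> K * norm m"
    using additive_continuous_bounded by blast
  show "c *\<^sub>C \<phi> \<in> homs_M" for c
  proof -
    have "continuous_on UNIV (\<lambda>m. c *\<^sub>C \<phi> m)"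
    proof (rule bounded_additive_continuous)
      show "norm (c *\<^sub>C \<phi> m) \<le> (cmod c * K) * norm m" for m
        using K[of m] by (simp add: norm_scaleC mult.assoc mult_left_mono)
    qed (simp add: add scaleC_add_right)
    then show ?thesis
      using \<phi> by (simp add: homs_M_iff scaleC_fun_def scaleC_add_right)
  qed
  fix \<phi>' assume \<phi>': "\<phi>' \<in> homs_M"
  then have [simp]: "\<phi>' m \<in> XM" for m
    by (simp add: homs_M_iff)
  have "continuous_on UNIV (\<phi> + \<phi>')"
    using \<phi> \<phi>' by (auto simp: homs_M_iff plus_fun_def intro: continuous_on_add)
  then show "\<phi> + \<phi>' \<in> homs_M"
    using \<phi> \<phi>' by (simp add: homs_M_iff)
qed

lemma ZR_M_subspace: "csubspace ZR_M"
  unfolding complex_vector.subspace_def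
proof (intro conjI ballI allI)
  show "0 \<in> ZR_M"
    unfolding ZR_M_iff
    by (rule bexI[of _ 0], rule bexI[of _ 0]) (simp_all add: zero_fun_def)
  fix \<phi> assume "\<phi> \<in> ZR_M"
  then obtain x z where \<phi>: "x \<in> XA" "z \<in> XB" "\<forall>a. RA a x = LA a x" "\<forall>b. RB b z = LB b z"
      "\<phi> = (\<lambda>m. extA m x - extB m z)"
    unfolding ZR_M_iff by blast
  then show "c *\<^sub>C \<phi> \<in> ZR_M" for c
    unfolding ZR_M_iff
    by (intro bexI[of _ "c *\<^sub>C x"] bexI[of _ "c *\<^sub>C z"]) (simp_all add: scaleC_fun_def complex_vector.scale_right_diff_distrib)
  fix \<phi>' assume "\<phi>' \<in> ZR_M"
  then obtain x' z' where \<phi>': "x' \<in> XA" "z' \<in> XB" "\<forall>a. RA a x' = LA a x'" "\<forall>b. RB b z' = LB b z'"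
      "\<phi>' = (\<lambda>m. extA m x' - extB m z')"
    unfolding ZR_M_iff by blast
  show "\<phi> + \<phi>' \<in> ZR_M"
    unfolding ZR_M_iff using \<phi> \<phi>'
    by (intro bexI[of _ "x + x'"] bexI[of _ "z + z'"]) (simp_all add: plus_fun_def add_diff_add)
qed

section \<open>The maps given by multiplication with bidual elements\<close>

text \<open>Each identity is a distributive, associative or scalar law of the module, lifted by
  functoriality.\<close>

lemma extA_simps:
  assumes [simp]: "x \<in> XA"
  shows "extA (m + m') x = extA m x + extA m' x" "extA (actA a m) x = extA m (RA a x)"
    and "extA (actB m b) x = RM b (extA m x)" "extA (lM \<alpha> m) x = KM \<alpha> (extA m x)"
    and "LM a (extA m x) = extA m (LA a x)"
  by (simp_all add: top_bidual_comp act_mult scalar_mult flip: top_bidual_add)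

lemma extB_simps:
  assumes [simp]: "z \<in> XB"
  shows "extB (m + m') z = extB m z + extB m' z" "extB (actA a m) z = LM a (extB m z)"
    and "extB (actB m b) z = extB m (LB b z)" "extB (lM \<alpha> m) z = KM \<alpha> (extB m z)"
    and "RM b (extB m z) = extB m (RB b z)"
proof -
  \<comment> \<open>\<open>extB\<close> uses \<open>actB m\<close> unapplied; as explicit functions
    these maps become sums and composites to which the bidual rules apply.\<close>
  have "actB (m + m') = (\<lambda>b. actB m b + actB m' b)" "actB (actA a m) = (\<lambda>b. actA a (actB m b))"
    "actB (actB m b) = (\<lambda>b'. actB m (b * b'))" "actB (lM \<alpha> m) = (\<lambda>b. lM \<alpha> (actB m b))"
    by (simp_all add: fun_eq_iff act_mult scalar_mult)
  then show "extB (m + m') z = extB m z + extB m' z" "extB (actA a m) z = LM a (extB m z)"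
    "extB (actB m b) z = extB m (LB b z)" "extB (lM \<alpha> m) z = KM \<alpha> (extB m z)"
    by (simp_all add: top_bidual_comp flip: top_bidual_add)
qed (simp add: top_bidual_comp act_mult)

text \<open>The bidual keeps the operator bound, which is a multiple of the norm of m, so the value
  at a fixed x or z is bounded in m.\<close>

lemma ext_continuous:
  shows "x \<in> XA \<Longrightarrow> continuous_on UNIV (\<lambda>m. extA m x)"
    and "z \<in> XB \<Longrightarrow> continuous_on UNIV (\<lambda>m. extB m z)"
proof -
  assume x: "x \<in> XA"
  obtain C where C: "\<And>m. bounded_clinear_on UNIV UNIV (C * norm m) (\<lambda>a. actA a m)"
    using bounded_cbilinear_bounds[OF bilinear(1)] by blast
  show "continuous_on UNIV (\<lambda>m. extA m x)"
  proof (rule bounded_additive_continuous[OF extA_simps(1)[OF x]])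
    show "norm (extA m x) \<le> (C * norm x) * norm m" for m
      using bidual_bounded_on[OF EA EM C order_refl, of m] x
      by (simp add: bounded_clinear_on_def mult_ac)
  qed
next
  assume z: "z \<in> XB"
  obtain C where C: "\<And>m. bounded_clinear_on UNIV UNIV (C * norm m) (actB m)"
    using bounded_cbilinear_bounds[OF bilinear(2)] by blast
  show "continuous_on UNIV (\<lambda>m. extB m z)"
  proof (rule bounded_additive_continuous[OF extB_simps(1)[OF z]])
    show "norm (extB m z) \<le> (C * norm z) * norm m" for m
      using bidual_bounded_on[OF EB EM C order_refl, of m] z
      by (simp add: bounded_clinear_on_def mult_ac)
  qed
qed

text \<open>Centrality yields the module laws: x (a m) = (x a) m = (a x) m = a (x m), and likewise
  for z on the right.\<close>

lemma ZR_M_le: "ZR_M \<subseteq> homs_M"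
proof
  fix \<phi> assume "\<phi> \<in> ZR_M"
  then obtain x z where \<phi> [simp]: "x \<in> XA" "z \<in> XB" "\<forall>a. RA a x = LA a x" "\<forall>b. RB b z = LB b z"
      "\<phi> = (\<lambda>m. extA m x - extB m z)"
    unfolding ZR_M_iff by blast
  show "\<phi> \<in> homs_M"
    using continuous_on_diff[OF ext_continuous(1) ext_continuous(2), of x z]
    by (auto simp: homs_M_iff extA_simps extB_simps top_bidual_add)
qed

section \<open>Derivations supported in the corner\<close>

text \<open>The linear map from homomorphisms to derivations that induces the isomorphism.\<close>

definition corner :: "('m \<Rightarrow> 'um) \<Rightarrow> ('a, 'm, 'b) tri \<Rightarrow> 'ut" where
  "corner \<phi> t = jM (\<phi> (ur t))"

lemma corner_add: "\<phi> \<in> homs_M \<Longrightarrow> \<psi> \<in> homs_M \<Longrightarrow> corner (\<phi> + \<psi>) = corner \<phi> + corner \<psi>"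
  and corner_scale: "\<phi> \<in> homs_M \<Longrightarrow> corner (c *\<^sub>C \<phi>) = c *\<^sub>C corner \<phi>"
  by (auto simp: corner_def homs_M_iff scaleC_fun_def)

text \<open>Only the corner entry of the Leibniz rule has content, and there it reads \<phi>(a m' +
  m b') = a \<phi>(m') + \<phi>(m) b'.\<close>

lemma corner_derivation:
  assumes \<phi>: "\<phi> \<in> homs_M"
  shows "corner \<phi> \<in> derivations_T"
proof -
  have [simp]: "\<phi> m \<in> XM" for m
    using \<phi> by (simp add: homs_M_iff)
  have \<phi>': "\<phi> (m + m') = \<phi> m + \<phi> m'" "\<phi> (actA a m) = LM a (\<phi> m)" "\<phi> (actB m b) = RM b (\<phi> m)"
    "\<phi> (lM \<alpha> m) = KM \<alpha> (\<phi> m)" for m m' a b \<alpha>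
    using \<phi> by (simp_all add: homs_M_iff)
  obtain K where K: "\<And>m. norm (\<phi> m) \<le> K * norm m"
    using additive_continuous_bounded \<phi> unfolding homs_M_iff by blast
  obtain L where L: "\<And>y. y \<in> XM \<Longrightarrow> norm (jM y) \<le> L * norm y"
    using bidual_bound[OF EM ET, of "\<lambda>m. Tri 0 m 0"] by auto
  have "norm (corner \<phi> t) \<le> (\<bar>L\<bar> * \<bar>K\<bar>) * norm t" for t
  proof -
    have "norm (corner \<phi> t) \<le> \<bar>L\<bar> * norm (\<phi> (ur t))"
      using L[of "\<phi> (ur t)"] unfolding corner_def
      by (meson \<open>\<And>m. \<phi> m \<in> XM\<close> abs_ge_self mult_right_mono norm_ge_zero order_trans)
    also have "norm (\<phi> (ur t)) \<le> \<bar>K\<bar> * norm (ur t)"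
      using K[of "ur t"] by (meson abs_ge_self mult_right_mono norm_ge_zero order_trans)
    also have "norm (ur t) \<le> norm t"
      by (simp add: norm_tri_def)
    finally show ?thesis
      by (simp add: mult.assoc mult_left_mono)
  qed
  then have "\<exists>K. \<forall>t. norm (corner \<phi> t) \<le> K * norm t" by blast
  then show ?thesis
    by (auto simp: derivations_T_iff corner_def \<phi>'
        projections_act intro!: triangular_dual_eqI)
qed

text \<open>Evaluating an implementing element on the three kinds of matrix units shows that its
  diagonal entries are central and that \<phi> is the map they define.\<close>

lemma corner_inner_iff:
  assumes \<phi>: "\<phi> \<in> homs_M"
  shows "corner \<phi> \<in> inner_T \<longleftrightarrow> \<phi> \<in> ZR_M"
proof -
  have mem [simp]: "\<phi> m \<in> XM" for m
    using \<phi> by (simp add: homs_M_iff)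
  have zero [simp]: "\<phi> 0 = 0"
    using \<phi> by (metis add_cancel_right_left homs_M_iff)
  show ?thesis
  proof
    assume "corner \<phi> \<in> inner_T"
    then obtain \<xi> where \<xi> [simp]: "\<xi> \<in> XT" and inner: "\<And>t. corner \<phi> t = TL t \<xi> - TR t \<xi>"
      by (auto simp: inner_T_iff)
    have "LA a (qA \<xi>) = RA a (qA \<xi>)" for a
      using arg_cong[OF inner[of "Tri a 0 0"], of qA] by (simp add: corner_def projections_act)
    moreover have "LB b (qB \<xi>) = RB b (qB \<xi>)" for b
      using arg_cong[OF inner[of "Tri 0 0 b"], of qB] by (simp add: corner_def projections_act)
    moreover have "\<phi> m = extB m (qB \<xi>) - extA m (qA \<xi>)" for m
      using arg_cong[OF inner[of "Tri 0 m 0"], of qM] by (simp add: corner_def projections_act)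
    ultimately show "\<phi> \<in> ZR_M"
      unfolding ZR_M_iff
      \<comment> \<open>The commutator has corner m z - x m, while \<open>ZR_M\<close> uses x m - m
        z; hence the signs, here and in the converse.\<close>
      by (intro bexI[of _ "- qA \<xi>"] bexI[of _ "- qB \<xi>"]) (simp_all add: fun_eq_iff)
  next
    assume "\<phi> \<in> ZR_M"
    then obtain x z where [simp]: "x \<in> XA" "z \<in> XB" and "\<forall>a. RA a x = LA a x" "\<forall>b. RB b z = LB b z"
      and "\<phi> = (\<lambda>m. extA m x - extB m z)"
      unfolding ZR_M_iff by blast
    then have "\<forall>t. corner \<phi> t = TL t (jA (- x) + jB (- z)) - TR t (jA (- x) + jB (- z))"
      by (auto simp: corner_def projections_act intro!: triangular_dual_eqI)
    then show "corner \<phi> \<in> inner_T"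
      using corner_derivation[OF \<phi>] by (auto simp: inner_T_iff intro!: bexI[of _ "jA (- x) + jB (- z)"])
  qed
qed

section \<open>Reduction of a given derivation modulo inner ones\<close>

context
  fixes D
  assumes D: "D \<in> derivations_T"
    and bai: "(\<exists>F :: 'a filter. bounded_approximate_identity F) \<or>
      (\<exists>F :: 'b filter. bounded_approximate_identity F)"
    and ndA: "nondegenerate XA (dual_left EA (2 * n) (*) (*)) (dual_right EA (2 * n) (*) (*))"
    and ndB: "nondegenerate XB (dual_left EB (2 * n) (*) (*)) (dual_right EB (2 * n) (*) (*))"
    and ndM: "nondegenerate XM (even_dual_left EM n actA) (even_dual_right EM n actB)"
    and amA: "weakly_module_amenable (2 * n) lA rA EA"
    and amB: "weakly_module_amenable (2 * n) lB rB EB"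
begin

lemma nondegenerate_actions:
  "nondegenerate XA LA (\<lambda>x a. RA a x)" "nondegenerate XB LB (\<lambda>z b. RB b z)"
  "nondegenerate XM LM (\<lambda>y b. RM b y)"
proof -
  have "dual_left EA (2 * n) (*) (*) = LA" "dual_right EA (2 * n) (*) (*) = (\<lambda>x a. RA a x)"
    "dual_left EB (2 * n) (*) (*) = LB" "dual_right EB (2 * n) (*) (*) = (\<lambda>z b. RB b z)"
    "even_dual_left EM n actA = LM" "even_dual_right EM n actB = (\<lambda>y b. RM b y)"
    by (simp_all add: fun_eq_iff dual_left_def dual_right_def even_dual_left_def
        even_dual_right_def iterated_dual_map_even)
  then show "nondegenerate XA LA (\<lambda>x a. RA a x)" "nondegenerate XB LB (\<lambda>z b. RB b z)"
    "nondegenerate XM LM (\<lambda>y b. RM b y)"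
    using ndA ndB ndM by simp_all
qed

lemma derivation_mem [simp]: "D t \<in> XT"
  and derivation_add: "D (s + t) = D s + D t"
  and derivation_scalar: "D (kmul \<alpha> t) = KT \<alpha> (D t)"
  and leibniz: "D (mul s t) = TR t (D s) + TL s (D t)"
  using D by (auto simp: derivations_T_iff)

lemma derivation_zero: "D (Tri 0 0 0) = 0"
  using derivation_add[of "Tri 0 0 0" "Tri 0 0 0"] by (simp add: plus_tri_def)

lemma leibniz_entries:
  "qA (D (mul s t)) = RA (ul t) (qA (D s)) + LA (ul s) (qA (D t))"
  "qM (D (mul s t)) = extA (ur t) (qA (D s)) + RM (lr t) (qM (D s)) +
     (LM (ul s) (qM (D t)) + extB (ur s) (qB (D t)))"
  "qB (D (mul s t)) = RB (lr t) (qB (D s)) + LB (lr s) (qB (D t))"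
  by (simp_all add: leibniz projections_act)

lemma bound_components:
  assumes "\<exists>K. \<forall>\<xi> \<in> XT. norm (q \<xi>) \<le> K * norm \<xi>" and "\<And>x. norm (j x) = norm x"
  shows "\<exists>K. \<forall>x. norm (q (D (j x))) \<le> K * norm x"
proof -
  obtain K where K: "\<And>\<xi>. \<xi> \<in> XT \<Longrightarrow> norm (q \<xi>) \<le> K * norm \<xi>"
    using assms(1) by blast
  obtain L where L: "\<And>t. norm (D t) \<le> L * norm t"
    using D by (auto simp: derivations_T_iff)
  have "norm (q (D (j x))) \<le> (\<bar>K\<bar> * L) * norm x" for x
  proof -
    have "norm (q (D (j x))) \<le> \<bar>K\<bar> * norm (D (j x))"
      using K[of "D (j x)"] by (meson derivation_mem abs_ge_self mult_right_mono norm_ge_zero order_trans)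
    also have "\<dots> \<le> \<bar>K\<bar> * (L * norm x)"
      using L[of "j x"] by (simp add: assms(2) mult_left_mono)
    finally show ?thesis by (simp add: mult.assoc)
  qed
  then show ?thesis by blast
qed

lemma component_bounds:
  "\<exists>K. \<forall>a. norm (qA (D (Tri a 0 0))) \<le> K * norm a" "\<exists>K. \<forall>a. norm (qM (D (Tri a 0 0))) \<le> K * norm a"
  "\<exists>K. \<forall>m. norm (qM (D (Tri 0 m 0))) \<le> K * norm m" "\<exists>K. \<forall>b. norm (qM (D (Tri 0 0 b))) \<le> K * norm b"
  "\<exists>K. \<forall>b. norm (qB (D (Tri 0 0 b))) \<le> K * norm b"
proof -
  note K = bidual_bound[OF ET EA bounded_clinear_actions(7)] and L = bidual_bound[OF ET EM bounded_clinear_actions(8)]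
    and M = bidual_bound[OF ET EB bounded_clinear_actions(9)]
  show "\<exists>K. \<forall>a. norm (qA (D (Tri a 0 0))) \<le> K * norm a"
    by (rule bound_components[OF K]) (simp_all add: norm_tri_def)
  show "\<exists>K. \<forall>a. norm (qM (D (Tri a 0 0))) \<le> K * norm a" "\<exists>K. \<forall>m. norm (qM (D (Tri 0 m 0))) \<le> K * norm m"
    "\<exists>K. \<forall>b. norm (qM (D (Tri 0 0 b))) \<le> K * norm b"
    by (rule bound_components[OF L], simp_all add: norm_tri_def)+
  show "\<exists>K. \<forall>b. norm (qB (D (Tri 0 0 b))) \<le> K * norm b"
    by (rule bound_components[OF M]) (simp_all add: norm_tri_def)
qed

text \<open>Each entry is multiplied by a diagonal unit chosen so that the product of the two
  matrices is zero. The Leibniz rule then shows that an algebra annihilates the entry, and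
  nondegeneracy kills it.\<close>

lemma vanishing_components:
  "qB (D (Tri a 0 0)) = 0" "qA (D (Tri 0 0 b)) = 0" "qA (D (Tri 0 m 0)) = 0" "qB (D (Tri 0 m 0)) = 0"
proof -
  show "qB (D (Tri a 0 0)) = 0"
  proof (rule nondegenerateD(2)[OF nondegenerate_actions(2)])
    show "RB b (qB (D (Tri a 0 0))) = 0" for b
      using leibniz_entries(3)[of "Tri a 0 0" "Tri 0 0 b"] by (simp add: mul_units derivation_zero)
  qed simp
  show "qA (D (Tri 0 0 b)) = 0"
  proof (rule nondegenerateD(1)[OF nondegenerate_actions(1)])
    show "LA a (qA (D (Tri 0 0 b))) = 0" for a
      using leibniz_entries(1)[of "Tri a 0 0" "Tri 0 0 b"] by (simp add: mul_units derivation_zero)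
  qed simp
  show "qA (D (Tri 0 m 0)) = 0"
  proof (rule nondegenerateD(2)[OF nondegenerate_actions(1)])
    show "RA a (qA (D (Tri 0 m 0))) = 0" for a
      using leibniz_entries(1)[of "Tri 0 m 0" "Tri a 0 0"] by (simp add: mul_units derivation_zero)
  qed simp
  show "qB (D (Tri 0 m 0)) = 0"
  proof (rule nondegenerateD(1)[OF nondegenerate_actions(2)])
    show "LB b (qB (D (Tri 0 m 0))) = 0" for b
      using leibniz_entries(3)[of "Tri 0 0 b" "Tri 0 m 0"] by (simp add: mul_units derivation_zero)
  qed simp
qed

text \<open>Compressing D to a diagonal block gives a module derivation of that algebra into its own
  dual, to which weak module amenability applies.\<close>

lemma diagonal_inner:
  obtains x z where "x \<in> XA" "z \<in> XB" "\<And>a. qA (D (Tri a 0 0)) = LA a x - RA a x"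
    and "\<And>b. qB (D (Tri 0 0 b)) = LB b z - RB b z"
proof -
  have "(\<lambda>a. qA (D (Tri a 0 0))) \<in> dual_derivations (2 * n) (*) lA rA EA"
    unfolding dual_derivations_even[where r = rA and l = lA, OF right_actions(1)]
    using leibniz_entries(1)[of "Tri _ 0 0" "Tri _ 0 0"] derivation_add[of "Tri _ 0 0" "Tri _ 0 0"]
      derivation_scalar[of _ "Tri _ 0 0"] component_bounds(1)
    by (simp add: mul_units kmul_units plus_tri_def projections_act)
  from bspec[OF weakly_module_amenableD[OF amA] this]
  obtain x where x: "x \<in> XA" "\<And>a. qA (D (Tri a 0 0)) = LA a x - RA a x"
    by blast
  have "(\<lambda>b. qB (D (Tri 0 0 b))) \<in> dual_derivations (2 * n) (*) lB rB EB"
    unfolding dual_derivations_even[where r = rB and l = lB, OF right_actions(2)]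
    using leibniz_entries(3)[of "Tri 0 0 _" "Tri 0 0 _"] derivation_add[of "Tri 0 0 _" "Tri 0 0 _"]
      derivation_scalar[of _ "Tri 0 0 _"] component_bounds(5)
    by (simp add: mul_units kmul_units plus_tri_def projections_act)
  from bspec[OF weakly_module_amenableD[OF amB] this]
  obtain z where z: "z \<in> XB" "\<And>b. qB (D (Tri 0 0 b)) = LB b z - RB b z"
    by blast
  show ?thesis using that x z by blast
qed

text \<open>On the diagonal blocks the corner of D is a one-sided module map, which the approximate
  identity represents by an element y. The other block is then forced by nondegeneracy.\<close>

lemma corner_inner:
  obtains y where "y \<in> XM" "\<And>a. qM (D (Tri a 0 0)) = LM a y" "\<And>b. qM (D (Tri 0 0 b)) = - RM b y"
proof -
  define \<delta> where "\<delta> a = qM (D (Tri a 0 0))" for a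
  define \<epsilon> where "\<epsilon> b = qM (D (Tri 0 0 b))" for b
  have mem [simp]: "\<delta> a \<in> XM" "\<epsilon> b \<in> XM" for a b
    by (simp_all add: \<delta>_def \<epsilon>_def)
  have add: "\<delta> (a + a') = \<delta> a + \<delta> a'" "\<epsilon> (b + b') = \<epsilon> b + \<epsilon> b'" for a a' b b'
    using derivation_add[of "Tri a 0 0" "Tri a' 0 0"] derivation_add[of "Tri 0 0 b" "Tri 0 0 b'"]
    by (simp_all add: \<delta>_def \<epsilon>_def plus_tri_def)
  have bnd: "\<exists>K. \<forall>a. norm (\<delta> a) \<le> K * norm a" "\<exists>K. \<forall>b. norm (\<epsilon> b) \<le> K * norm b"
    using component_bounds(2,4) by (simp_all add: \<delta>_def \<epsilon>_def)
  have \<delta>: "\<delta> (a * a') = LM a (\<delta> a')" for a a'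
    using leibniz_entries(2)[of "Tri a 0 0" "Tri a' 0 0"] by (simp add: mul_units \<delta>_def)
  have \<epsilon>: "\<epsilon> (b * b') = RM b' (\<epsilon> b)" for b b'
    using leibniz_entries(2)[of "Tri 0 0 b" "Tri 0 0 b'"] by (simp add: mul_units \<epsilon>_def)
  \<comment> \<open>The two diagonal units multiply to zero, so the Leibniz rule couples the
    blocks.\<close>
  have \<delta>\<epsilon>: "RM b (\<delta> a) = - LM a (\<epsilon> b)" for a b
    using leibniz_entries(2)[of "Tri a 0 0" "Tri 0 0 b"]
    by (simp add: mul_units derivation_zero \<delta>_def \<epsilon>_def eq_neg_iff_add_eq_0)
  have swap: "RM b (LM a y) = LM a (RM b y)" if "y \<in> XM" for a b y
    using that by (simp add: top_bidual_comp act_mult)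
  have "\<exists>y \<in> XM. (\<forall>a. \<delta> a = LM a y) \<and> (\<forall>b. \<epsilon> b = - RM b y)"
    using bai
  proof
    assume "\<exists>F :: 'a filter. bounded_approximate_identity F"
    then obtain F :: "'a filter" where F: "bounded_approximate_identity F" ..
    note lims = bounded_approximate_identity_limits[OF F, of \<delta>, OF add(1) bnd(1)]
    obtain K where K: "\<forall>\<^sub>F e in F. norm (\<delta> e) \<le> K"
      using lims(2) by blast
    \<comment> \<open>The hypothesis needed is a \<delta>(e) = \<delta>(a e), which tends to
      \<delta>(a).\<close>
    obtain y where y [simp]: "y \<in> XM" and \<delta>y: "\<And>a. LM a y = \<delta> a"
      using weak_star_module_element[where S = actA and \<eta> = \<delta>, OF n EM _ lims(1) _ K] lims(4)
      by (auto simp: \<delta>)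
    have "\<epsilon> b + RM b y = 0" for b
    proof (rule nondegenerateD(1)[OF nondegenerate_actions(3)])
      \<comment> \<open>Moving a past b turns the second term into \<delta>(a) b, which cancels the
        first by the coupling.\<close>
      show "LM a (\<epsilon> b + RM b y) = 0" for a
        using \<delta>\<epsilon>[of b a] by (simp add: swap flip: \<delta>y)
    qed simp
    then show ?thesis
      using y \<delta>y by (auto simp: eq_neg_iff_add_eq_0 intro!: bexI[of _ y])
  next
    assume "\<exists>F :: 'b filter. bounded_approximate_identity F"
    then obtain F :: "'b filter" where F: "bounded_approximate_identity F" ..
    note lims = bounded_approximate_identity_limits[OF F, of \<epsilon>, OF add(2) bnd(2)]
    obtain K where K: "\<forall>\<^sub>F e in F. norm (\<epsilon> e) \<le> K"
      using lims(2) by blast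
    obtain y where y [simp]: "y \<in> XM" and \<epsilon>y: "\<And>b. RM b y = \<epsilon> b"
      using weak_star_module_element[where S = "\<lambda>b m. actB m b" and \<eta> = \<epsilon>, OF n EM _ lims(1) _ K] lims(3)
      by (auto simp: \<epsilon>)
    have "\<delta> a + LM a y = 0" for a
    proof (rule nondegenerateD(2)[OF nondegenerate_actions(3)])
      show "RM b (\<delta> a + LM a y) = 0" for b
        using \<delta>\<epsilon>[of b a] by (simp add: swap flip: \<epsilon>y)
    qed simp
    then show ?thesis
      \<comment> \<open>Here y represents \<epsilon> with the opposite sign, so - y is the
        witness.\<close>
      using y \<epsilon>y by (auto simp: eq_neg_iff_add_eq_0 intro!: bexI[of _ "- y"])
  qed
  then show ?thesis
    using that by (auto simp: \<delta>_def \<epsilon>_def)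
qed

text \<open>The restriction e of D to the corner fails to be a module map by terms coming from x and
  z. Adding x m - m z, although x and z need not be central, cancels this defect.\<close>

lemma derivation_modulo_inner: "\<exists>\<phi> \<in> homs_M. D - corner \<phi> \<in> inner_T"
proof -
  obtain x z where [simp]: "x \<in> XA" "z \<in> XB" and x: "\<And>a. qA (D (Tri a 0 0)) = LA a x - RA a x"
    and z: "\<And>b. qB (D (Tri 0 0 b)) = LB b z - RB b z"
    using diagonal_inner by blast
  obtain y where [simp]: "y \<in> XM" and y: "\<And>a. qM (D (Tri a 0 0)) = LM a y"
    "\<And>b. qM (D (Tri 0 0 b)) = - RM b y"
    using corner_inner by blast
  define e where "e m = qM (D (Tri 0 m 0))" for m
  have [simp]: "e m \<in> XM" for m by (simp add: e_def)
  have e_add: "e (m + m') = e m + e m'" for m m'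
    using derivation_add[of "Tri 0 m 0" "Tri 0 m' 0"] by (simp add: e_def plus_tri_def)
  have e_left: "e (actA a m) = extA m (LA a x) - extA m (RA a x) + LM a (e m)" for a m
    using leibniz_entries(2)[of "Tri a 0 0" "Tri 0 m 0"]
    by (simp add: mul_units e_def x vanishing_components)
  have e_right: "e (actB m b) = RM b (e m) + (extB m (LB b z) - extB m (RB b z))" for m b
    using leibniz_entries(2)[of "Tri 0 m 0" "Tri 0 0 b"]
    by (simp add: mul_units e_def z vanishing_components)
  have e_scalar: "e (lM \<alpha> m) = KM \<alpha> (e m)" for \<alpha> m
    using derivation_scalar[of \<alpha> "Tri 0 m 0"] by (simp add: kmul_units e_def projections_act)
  obtain K where K: "\<And>m. norm (e m) \<le> K * norm m"
    using component_bounds(3) by (auto simp: e_def)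
  define \<phi> where "\<phi> m = e m + (extA m x - extB m z)" for m
  have "continuous_on UNIV \<phi>"
    unfolding \<phi>_def
    by (intro continuous_on_add continuous_on_diff ext_continuous
        bounded_additive_continuous[OF e_add K]) simp_all
  then have \<phi>: "\<phi> \<in> homs_M"
    by (simp add: homs_M_iff \<phi>_def e_add e_left e_right e_scalar extA_simps extB_simps top_bidual_add)
  \<comment> \<open>The corner of its commutator contains m z - x m, exactly the difference between
    e and \<phi>.\<close>
  define \<xi> where "\<xi> = jA x + jM y + jB z"
  have "(D - corner \<phi>) t = TL t \<xi> - TR t \<xi>" for t
  proof -
    have "t = Tri (ul t) 0 0 + (Tri 0 (ur t) 0 + Tri 0 0 (lr t))"
      by (simp add: plus_tri_def)
    then have "D t = D (Tri (ul t) 0 0) + (D (Tri 0 (ur t) 0) + D (Tri 0 0 (lr t)))"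
      by (metis derivation_add)
    then have "qA (D t) = LA (ul t) x - RA (ul t) x" "qB (D t) = LB (lr t) z - RB (lr t) z"
      "qM (D t) = LM (ul t) y + (e (ur t) - RM (lr t) y)"
      by (simp_all add: x z y vanishing_components e_def)
    then show ?thesis
      by (intro triangular_dual_eqI) (simp_all add: corner_def \<xi>_def \<phi>_def projections_act)
  qed
  moreover have "D - corner \<phi> \<in> derivations_T"
    by (rule complex_vector.subspace_diff[OF derivations_T_subspace D corner_derivation[OF \<phi>]])
  ultimately have "D - corner \<phi> \<in> inner_T"
    unfolding inner_T_iff by (auto intro!: bexI[of _ \<xi>] simp: \<xi>_def)
  then show ?thesis using \<phi> by blast
qed

end

end

section \<open>The first module cohomology of the triangular algebra\<close>

theorem theorem5p3:
  fixes n :: nat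
    and lA :: "'k::complex_banach_algebra \<Rightarrow> 'a::complex_banach_algebra \<Rightarrow> 'a"
    and rA :: "'a \<Rightarrow> 'k \<Rightarrow> 'a"
    and lB :: "'k \<Rightarrow> 'b::complex_banach_algebra \<Rightarrow> 'b"
    and rB :: "'b \<Rightarrow> 'k \<Rightarrow> 'b"
    and lM :: "'k \<Rightarrow> 'm::complex_banach \<Rightarrow> 'm"
    and rM :: "'m \<Rightarrow> 'k \<Rightarrow> 'm"
    and act\<^sub>A :: "'a \<Rightarrow> 'm \<Rightarrow> 'm"
    and act\<^sub>B :: "'m \<Rightarrow> 'b \<Rightarrow> 'm"
    and EA :: "('a, 'ua::complex_normed_vector) dual_tower"
    and EB :: "('b, 'ub::complex_normed_vector) dual_tower"
    and EM :: "('m, 'um::complex_normed_vector) dual_tower"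
    and ET :: "(('a, 'm, 'b) tri, 'ut::complex_normed_vector) dual_tower"
  assumes "n \<ge> 1"
    and "banach_algebra_module lA rA" and "commutative_actions lA rA"
    and "banach_algebra_module lB rB" and "commutative_actions lB rB"
    and "banach_AB_module lA rB lM rM act\<^sub>A act\<^sub>B" and "commutative_actions lM rM"
    and "iterated_dual (2 * n) {0} EA"
    and "iterated_dual (2 * n) {0} EB"
    and "iterated_dual (2 * n) {0} EM"
    and "iterated_dual (2 * n) {0} ET"
    and "(\<exists>F :: 'a filter. bounded_approximate_identity F) \<or>
         (\<exists>F :: 'b filter. bounded_approximate_identity F)"
    and "nondegenerate (lev EA (2 * n))
           (dual_left EA (2 * n) (*) (*)) (dual_right EA (2 * n) (*) (*))"
    and "nondegenerate (lev EB (2 * n))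
           (dual_left EB (2 * n) (*) (*)) (dual_right EB (2 * n) (*) (*))"
    and "nondegenerate (lev EM (2 * n)) (even_dual_left EM n act\<^sub>A) (even_dual_right EM n act\<^sub>B)"
    and "weakly_module_amenable (2 * n) lA rA EA"
    and "weakly_module_amenable (2 * n) lB rB EB"
  shows "quotients_isomorphic
    (dual_derivations (2 * n) (tri_mult act\<^sub>A act\<^sub>B)
       (diag_left lA lM lB) (diag_right rA rM rB) ET)
    (inner_dual_derivations (2 * n) (tri_mult act\<^sub>A act\<^sub>B)
       (diag_left lA lM lB) (diag_right rA rM rB) ET)
    (module_homs n EM lM rM act\<^sub>A act\<^sub>B)
    (ZR n EA EB EM act\<^sub>A act\<^sub>B)"
proof -
  interpret triangular_duals n lA rA lB rB lM rM act\<^sub>A act\<^sub>B EA EB EM ET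
    by (rule triangular_duals.intro; fact)
  show ?thesis
  \<comment> \<open>The map \<theta> is \<open>corner\<close>, so kernel and surjectivity are
    \<open>corner_inner_iff\<close> and \<open>derivation_modulo_inner\<close>.\<close>
  proof (rule quotients_isomorphicI)
    show "csubspace derivations_T" "csubspace inner_T" "csubspace homs_M" "csubspace ZR_M"
      by (fact derivations_T_subspace inner_T_subspace homs_M_subspace ZR_M_subspace)+
    show "inner_T \<subseteq> derivations_T"
      by (auto simp: inner_T_iff)
    show "ZR_M \<subseteq> homs_M"
      by (fact ZR_M_le)
    show "\<exists>\<phi> \<in> homs_M. D - corner \<phi> \<in> inner_T" if "D \<in> derivations_T" for D
      using that assms(12-17) by (rule derivation_modulo_inner)
  qed (fact corner_add corner_scale corner_derivation corner_inner_iff)+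
qed

end
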